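(* Let $\phi\colon A_1\to A_2$ be a regular star extendible embedding between finite dimensional nest algebras which is order conserving and order irreducible, and suppose that $A_1$ has no one dimensional (rank one) atoms. Then $\phi$ is either of $T_2$-degenerate type or of refinement type.
   Context: A finite dimensional nest algebra is a unital algebra $A\subseteq M_n(\mathbb{C})$ (or an operator algebra star extendibly isomorphic to one) associated with an ordered decomposition $1=q_1+\dots+q_l$ of the identity into nonzero orthogonal projections: $A$ consists of all $a\in M_n(\mathbb{C})$ with $(1-f)af=0$ for every $f=q_1+\dots+q_k$, $1\le k\le l$. The $q_i$ are the atomic interval projections (atoms) of $A$, totally ordered by $q_i\prec_A q_j$ for $i<j$; $A$ is the algebra of block upper triangular matrices for the block structure $v=(q_ivq_j)$, and $C^*(A)=M_n(\mathbb{C})$. $T_n\subseteq M_n(\mathbb{C})$ is the upper triangular matrix algebra (all atoms of rank one). A homomorphism (embedding, possibly nonunital) $A_1\to A_2$ is star extendible if it is the restriction of a $*$-homomorphism $C^*(A_1)\to C^*(A_2)$; it has multiplicity one if this extension maps rank one projections to rank one projections. It is regular if it is a direct sum of multiplicity one star extendible embeddings $A_1\to A_2$ (with pairwise orthogonal images of $1$). $\mathrm{Pisom}_{\mathrm{reg}}(A)$ is the set of partial isometries $v\in A$ all of whose blocks $q_ivq_j$ are partial isometries. $\mathrm{Pisom}_{\mathrm{oc}}(A)$ (order conserving partial isometries) is the set of $v\in \mathrm{Pisom}_{\mathrm{reg}}(A)$ such that $q_ivq_j\neq 0$ implies $q_svq_t=0$ for all $s<i$, $t>j$. A star extendible embedding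 $\phi\colon A_1\to A_2$ is order conserving if it maps $\mathrm{Pisom}_{\mathrm{oc}}(A_1)$ into $\mathrm{Pisom}_{\mathrm{oc}}(A_2)$, and locally order conserving if $\phi(v)\in\mathrm{Pisom}_{\mathrm{oc}}(A_2)$ for each rank one $v\in\mathrm{Pisom}_{\mathrm{reg}}(A_1)$. Ordered sums: if $\phi_1,\dots,\phi_r\colon A_1\to A_2$ are star extendible with pairwise orthogonal projections $\phi_i(1)$, then $\phi_1+\dots+\phi_r$ is an ordered sum if for all atoms $q\prec q'$ of $A_2$ and all $j<i$, $q\phi_i(1)\neq0$ implies $q'\phi_j(1)=0$. An embedding is order irreducible if it has no non-trivial ordered sum decomposition (i.e. it is not an ordered sum of two nonzero star extendible homomorphisms). Refinement type: a star extendible embedding $\phi\colon T_n\to T_m$ is of refinement type if it is locally order conserving and, whenever $e_1\prec_{T_n}e_2$ are distinct atoms of $T_n$, one has $f_1\prec_{T_m}f_2$ for all atoms $f_1\le\phi(e_1)$, $f_2\le\phi(e_2)$ of $T_m$. A star extendible embedding $\phi\colon A_1\to A_2$ of finite dimensional nest algebras is of refinement type if there are maximal triangular subalgebras $T_n\subseteq A_1$, $T_m\subseteq A_2$ (where $C^*(A_1)\cong M_n(\mathbb{C})$, $C^*(A_2)\cong M_m(\mathbb{C})$) with $\phi(T_n)\subseteq T_m$ such that $\phi|_{T_n}\colon T_n\to T_m$ is of refinement type. $\phi$ is of $T_2$-degenerate type if there are atoms $Q,Q'$ of $A_2$ with $\phi(1)\le Q+Q'$. *)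

theory Defs
  imports "HOL-Analysis.Analysis"
begin

(* M_n(C) is the type complex^'n^'n with CARD('n) = n; the product is **, the unit is mat 1. *)

definition adj :: "complex^'n^'n \<Rightarrow> complex^'n^'n" where
  "adj a = map_matrix cnj (transpose a)"

definition cscale :: "complex \<Rightarrow> complex^'n^'n \<Rightarrow> complex^'n^'n" where
  "cscale c a = map_matrix ((*) c) a"

definition projection :: "complex^'n^'n \<Rightarrow> bool" where
  "projection p \<longleftrightarrow> p ** p = p \<and> adj p = p"

definition partial_isometry :: "complex^'n^'n \<Rightarrow> bool" where
  "partial_isometry v \<longleftrightarrow> v ** adj v ** v = v"

(* The operator order a \<le> b: the quadratic form of b - a is real and nonnegative.  (Not the
   entrywise order that the type vec may carry.) *)
definition op_le :: "complex^'n^'n \<Rightarrow> complex^'n^'n \<Rightarrow> bool" where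
  "op_le a b \<longleftrightarrow>
     (\<forall>x. (\<Sum>i\<in>UNIV. cnj (x $ i) * ((b - a) *v x) $ i) \<in> \<real>\<^sub>\<ge>\<^sub>0)"

section \<open>Nest algebras\<close>

(* A nest algebra is presented by the ordered list of its atoms, the order being that of the list
   (positions counted from 0).  The atoms are arbitrary orthogonal projections, not necessarily
   diagonal ones. *)
definition nest_atoms :: "(complex^'n^'n) list \<Rightarrow> bool" where
  "nest_atoms qs \<longleftrightarrow>
     (\<forall>q\<in>set qs. projection q \<and> q \<noteq> 0) \<and>
     (\<forall>i<length qs. \<forall>j<length qs. i \<noteq> j \<longrightarrow> qs ! i ** qs ! j = 0) \<and>
     sum_list qs = mat 1"

definition nest_alg :: "(complex^'n^'n) list \<Rightarrow> (complex^'n^'n) set" where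
  "nest_alg qs =
     {a. \<forall>k\<in>{1..length qs}.
           (mat 1 - sum_list (take k qs)) ** a ** sum_list (take k qs) = 0}"

definition pisom_reg :: "(complex^'n^'n) list \<Rightarrow> (complex^'n^'n) set" where
  "pisom_reg qs =
     {v \<in> nest_alg qs. partial_isometry v \<and>
        (\<forall>i<length qs. \<forall>j<length qs. partial_isometry (qs ! i ** v ** qs ! j))}"

definition pisom_oc :: "(complex^'n^'n) list \<Rightarrow> (complex^'n^'n) set" where
  "pisom_oc qs =
     {v \<in> pisom_reg qs. \<forall>i<length qs. \<forall>j<length qs.
        qs ! i ** v ** qs ! j \<noteq> 0 \<longrightarrow>
        (\<forall>s t. s < i \<and> j < t \<and> t < length qs \<longrightarrow> qs ! s ** v ** qs ! t = 0)}"

section \<open>Star extendible homomorphisms\<close>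

(* *-homomorphisms M_n(C) \<rightarrow> M_m(C), possibly nonunital or zero. *)
definition star_hom :: "(complex^'n^'n \<Rightarrow> complex^'m^'m) \<Rightarrow> bool" where
  "star_hom \<pi> \<longleftrightarrow>
     (\<forall>a b. \<pi> (a + b) = \<pi> a + \<pi> b) \<and>
     (\<forall>c a. \<pi> (cscale c a) = cscale c (\<pi> a)) \<and>
     (\<forall>a b. \<pi> (a ** b) = \<pi> a ** \<pi> b) \<and>
     (\<forall>a. \<pi> (adj a) = adj (\<pi> a))"

(* A homomorphism A1 \<rightarrow> A2 is a function on all matrices of which only the values on A1 matter.
   The algebras A1, A2 generate the full matrix algebras as C*-algebras, so \<pi> is a map
   C*(A1) \<rightarrow> C*(A2), and it is determined by \<phi>. *)
definition star_extension ::
  "(complex^'n^'n) set \<Rightarrow> (complex^'n^'n \<Rightarrow> complex^'m^'m) \<Rightarrow>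
   (complex^'n^'n \<Rightarrow> complex^'m^'m) \<Rightarrow> bool" where
  "star_extension A1 \<phi> \<pi> \<longleftrightarrow> star_hom \<pi> \<and> (\<forall>a\<in>A1. \<pi> a = \<phi> a)"

definition star_extendible ::
  "(complex^'n^'n) set \<Rightarrow> (complex^'m^'m) set \<Rightarrow> (complex^'n^'n \<Rightarrow> complex^'m^'m) \<Rightarrow> bool" where
  "star_extendible A1 A2 \<phi> \<longleftrightarrow> \<phi> ` A1 \<subseteq> A2 \<and> (\<exists>\<pi>. star_extension A1 \<phi> \<pi>)"

definition star_extendible_embedding ::
  "(complex^'n^'n) set \<Rightarrow> (complex^'m^'m) set \<Rightarrow> (complex^'n^'n \<Rightarrow> complex^'m^'m) \<Rightarrow> bool" where
  "star_extendible_embedding A1 A2 \<phi> \<longleftrightarrow> star_extendible A1 A2 \<phi> \<and> inj_on \<phi> A1"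

definition multiplicity_one ::
  "(complex^'n^'n) set \<Rightarrow> (complex^'n^'n \<Rightarrow> complex^'m^'m) \<Rightarrow> bool" where
  "multiplicity_one A1 \<phi> \<longleftrightarrow>
     (\<exists>\<pi>. star_extension A1 \<phi> \<pi> \<and>
          (\<forall>p. projection p \<and> rank p = 1 \<longrightarrow> projection (\<pi> p) \<and> rank (\<pi> p) = 1))"

definition direct_sum ::
  "(complex^'n^'n) set \<Rightarrow> (complex^'n^'n \<Rightarrow> complex^'m^'m) \<Rightarrow>
   (complex^'n^'n \<Rightarrow> complex^'m^'m) list \<Rightarrow> bool" where
  "direct_sum A1 \<phi> \<psi>s \<longleftrightarrow>
     (\<forall>i<length \<psi>s. \<forall>j<length \<psi>s. i \<noteq> j \<longrightarrow> (\<psi>s ! i) (mat 1) ** (\<psi>s ! j) (mat 1) = 0) \<and>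
     (\<forall>a\<in>A1. \<phi> a = (\<Sum>\<psi>\<leftarrow>\<psi>s. \<psi> a))"

definition regular ::
  "(complex^'n^'n) set \<Rightarrow> (complex^'m^'m) set \<Rightarrow> (complex^'n^'n \<Rightarrow> complex^'m^'m) \<Rightarrow> bool" where
  "regular A1 A2 \<phi> \<longleftrightarrow>
     (\<exists>\<psi>s. (\<forall>\<psi>\<in>set \<psi>s. star_extendible_embedding A1 A2 \<psi> \<and> multiplicity_one A1 \<psi>) \<and>
           direct_sum A1 \<phi> \<psi>s)"

section \<open>Order conservation and ordered sums\<close>

definition order_conserving ::
  "(complex^'n^'n) list \<Rightarrow> (complex^'m^'m) list \<Rightarrow> (complex^'n^'n \<Rightarrow> complex^'m^'m) \<Rightarrow> bool" where
  "order_conserving qs1 qs2 \<phi> \<longleftrightarrow> \<phi> ` pisom_oc qs1 \<subseteq> pisom_oc qs2"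

definition locally_order_conserving ::
  "(complex^'n^'n) list \<Rightarrow> (complex^'m^'m) list \<Rightarrow> (complex^'n^'n \<Rightarrow> complex^'m^'m) \<Rightarrow> bool" where
  "locally_order_conserving qs1 qs2 \<phi> \<longleftrightarrow>
     (\<forall>v\<in>pisom_reg qs1. rank v = 1 \<longrightarrow> \<phi> v \<in> pisom_oc qs2)"

definition ordered_sum ::
  "(complex^'n^'n) list \<Rightarrow> (complex^'m^'m) list \<Rightarrow> (complex^'n^'n \<Rightarrow> complex^'m^'m) \<Rightarrow>
   (complex^'n^'n \<Rightarrow> complex^'m^'m) list \<Rightarrow> bool" where
  "ordered_sum qs1 qs2 \<phi> \<psi>s \<longleftrightarrow>
     (\<forall>\<psi>\<in>set \<psi>s. star_extendible (nest_alg qs1) (nest_alg qs2) \<psi>) \<and>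
     direct_sum (nest_alg qs1) \<phi> \<psi>s \<and>
     (\<forall>s t i j. s < t \<and> t < length qs2 \<and> j < i \<and> i < length \<psi>s \<longrightarrow>
        qs2 ! s ** (\<psi>s ! i) (mat 1) \<noteq> 0 \<longrightarrow> qs2 ! t ** (\<psi>s ! j) (mat 1) = 0)"

definition order_irreducible ::
  "(complex^'n^'n) list \<Rightarrow> (complex^'m^'m) list \<Rightarrow> (complex^'n^'n \<Rightarrow> complex^'m^'m) \<Rightarrow> bool" where
  "order_irreducible qs1 qs2 \<phi> \<longleftrightarrow>
     \<not> (\<exists>\<psi>1 \<psi>2. ordered_sum qs1 qs2 \<phi> [\<psi>1, \<psi>2] \<and>
          (\<exists>a\<in>nest_alg qs1. \<psi>1 a \<noteq> 0) \<and> (\<exists>a\<in>nest_alg qs1. \<psi>2 a \<noteq> 0))"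

section \<open>Maximal triangular subalgebras and refinement type\<close>

definition subalgebra :: "(complex^'n^'n) set \<Rightarrow> bool" where
  "subalgebra S \<longleftrightarrow>
     mat 1 \<in> S \<and> (\<forall>a\<in>S. \<forall>b\<in>S. a + b \<in> S \<and> a ** b \<in> S) \<and> (\<forall>c. \<forall>a\<in>S. cscale c a \<in> S)"

(* S is triangular if its diagonal, the intersection of S with its adjoint, is abelian. *)
definition triangular :: "(complex^'n^'n) set \<Rightarrow> bool" where
  "triangular S \<longleftrightarrow>
     subalgebra S \<and> (\<forall>a\<in>S. \<forall>b\<in>S. adj a \<in> S \<and> adj b \<in> S \<longrightarrow> a ** b = b ** a)"

definition maximal_triangular_in ::
  "(complex^'n^'n) set \<Rightarrow> (complex^'n^'n) set \<Rightarrow> bool" where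
  "maximal_triangular_in T A \<longleftrightarrow>
     triangular T \<and> T \<subseteq> A \<and> (\<forall>S. triangular S \<and> T \<subseteq> S \<and> S \<subseteq> A \<longrightarrow> S = T)"

(* nest_alg es is a copy of T_n, i.e. the upper triangular matrices in some orthonormal basis. *)
definition rank_one_atoms :: "(complex^'n^'n) list \<Rightarrow> bool" where
  "rank_one_atoms es \<longleftrightarrow> nest_atoms es \<and> (\<forall>e\<in>set es. rank e = 1)"

definition refinement_type_triangular ::
  "(complex^'n^'n) list \<Rightarrow> (complex^'m^'m) list \<Rightarrow> (complex^'n^'n \<Rightarrow> complex^'m^'m) \<Rightarrow> bool" where
  "refinement_type_triangular es fs \<phi> \<longleftrightarrow>
     star_extendible_embedding (nest_alg es) (nest_alg fs) \<phi> \<and>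
     locally_order_conserving es fs \<phi> \<and>
     (\<forall>i j. i < j \<and> j < length es \<longrightarrow>
        (\<forall>s<length fs. \<forall>t<length fs.
           op_le (fs ! s) (\<phi> (es ! i)) \<and> op_le (fs ! t) (\<phi> (es ! j)) \<longrightarrow> s < t))"

definition refinement_type ::
  "(complex^'n^'n) list \<Rightarrow> (complex^'m^'m) list \<Rightarrow> (complex^'n^'n \<Rightarrow> complex^'m^'m) \<Rightarrow> bool" where
  "refinement_type qs1 qs2 \<phi> \<longleftrightarrow>
     (\<exists>es fs. rank_one_atoms es \<and> rank_one_atoms fs \<and>
        maximal_triangular_in (nest_alg es) (nest_alg qs1) \<and>
        maximal_triangular_in (nest_alg fs) (nest_alg qs2) \<and>
        \<phi> ` nest_alg es \<subseteq> nest_alg fs \<and>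
        refinement_type_triangular es fs \<phi>)"

(* Q = Q' is allowed; this matters only when A2 has a single atom. *)
definition T2_degenerate ::
  "(complex^'m^'m) list \<Rightarrow> (complex^'n^'n \<Rightarrow> complex^'m^'m) \<Rightarrow> bool" where
  "T2_degenerate qs2 \<phi> \<longleftrightarrow> (\<exists>Q\<in>set qs2. \<exists>Q'\<in>set qs2. op_le (\<phi> (mat 1)) (Q + Q'))"

end

(* A multiplicity one summand is a |-> U a U* with an isometry U; it carries each atom of A1 into a
   single atom of A2, so it has a nondecreasing map sigma_i from the atoms of A1 to those of A2.
   Since the atoms of A1 have rank at least two, there are order conserving partial isometries with
   one piece in a diagonal block (k,k) and another in the block (k,L), or (0,k), where 0 and L are
   the first and last atoms.  Testing phi on these shows that sigma_i(k) < sigma_j(k) forces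
   sigma_i(L) <= sigma_j(k) and sigma_i(k) <= sigma_j(0).  Irreducibility then makes all sigma_i share
   their end values a <= b, and either all sigma_i coincide or all of them take only the values a and b.
   The latter is the T2-degenerate case.  In the former, let (x_j) be an orthonormal basis ordered
   along the atoms of A1; completing the vectors U_i x_j to a basis ordered lexicographically by
   (atom, j, i) gives the triangular subalgebra of A2 that exhibits phi as of refinement type. *)
theory Submission
  imports Defs
begin

section \<open>Complex vectors and matrices\<close>

text \<open>Rank at least two makes the tests possible: two pieces with a common row atom or a
  common column atom are never strictly nested, but they fit into one partial isometry only if that
  atom contains two orthogonal unit vectors. Every summand of phi copies both pieces, and copies
  from different summands may become strictly nested; forbidding this gives the inequalities.

  If sigma_i(L) <= sigma_j(0), summand i may precede summand j in an ordered sum, since a shared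
  boundary atom is permitted there. This is why the summands with lexicographically least pair of
  end values split off unless they are all of them.

  In the basis order, the atom has to come before j for the triangular algebra to lie in A2, and
  this agrees with the order by j only because the sigma_i coincide. With i last, the nonzero
  entries of the image of a matrix unit form an increasing chain, so none is strictly nested in
  another. Matrix units are enough: in a basis, a rank one partial isometry with partially isometric
  blocks is a unimodular multiple of one.\<close>

definition cin :: "complex^'n \<Rightarrow> complex^'n \<Rightarrow> complex" where
  "cin x y = (\<Sum>i\<in>UNIV. cnj (x $ i) * y $ i)"

definition outer :: "complex^'m \<Rightarrow> complex^'n \<Rightarrow> complex^'n^'m" where
  "outer x y = (\<chi> i j. x $ i * cnj (y $ j))"

text \<open>\<open>adj\<close> is available for square matrices only; the isometries from C^n to C^m
  need the adjoint of a rectangular matrix.\<close>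

definition ct :: "complex^'n^'m \<Rightarrow> complex^'m^'n" where
  "ct A = (\<chi> i j. cnj (A $ j $ i))"

lemma adj_eq_ct: "adj A = ct A"
  by (simp add: adj_def ct_def vec_eq_iff transpose_def)

lemma cin_add_right: "cin x (y + z) = cin x y + cin x z"
  by (simp add: cin_def algebra_simps sum.distrib)

lemma cin_diff_right: "cin x (y - z) = cin x y - cin x z"
  by (simp add: cin_def algebra_simps sum_subtractf)

lemma cin_scale_right [simp]: "cin x (c *s y) = c * cin x y"
  by (simp add: cin_def sum_distrib_left mult_ac)

lemma cin_scale_left [simp]: "cin (c *s x) y = cnj c * cin x y"
  by (simp add: cin_def sum_distrib_left mult_ac)

lemma cin_zero_left [simp]: "cin 0 y = 0"
  by (simp add: cin_def)

lemma cin_zero_right [simp]: "cin x 0 = 0"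
  by (simp add: cin_def)

lemma cin_sum_right: "cin x (sum f S) = (\<Sum>s\<in>S. cin x (f s))"
  by (induction S rule: infinite_finite_induct) (simp_all add: cin_add_right)

lemma cin_commute: "cin y x = cnj (cin x y)"
  by (simp add: cin_def mult_ac)

lemma cin_eq0_commute: "cin y x = 0 \<longleftrightarrow> cin x y = 0"
  by (subst cin_commute) simp

lemma cin_self: "cin x x = of_real (\<Sum>i\<in>UNIV. (cmod (x $ i))\<^sup>2)"
  by (simp add: cin_def mult.commute complex_norm_square[symmetric])

lemma cin_self_nonneg: "cin x x \<in> \<real>\<^sub>\<ge>\<^sub>0"
  unfolding cin_self by (intro nonneg_Reals_of_real_iff[THEN iffD2] sum_nonneg) auto

lemma cin_self_eq0: "cin x x = 0 \<longleftrightarrow> x = 0"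
proof -
  have "cin x x = 0 \<longleftrightarrow> (\<Sum>i\<in>UNIV. (cmod (x $ i))\<^sup>2) = 0"
    unfolding cin_self by (simp only: of_real_eq_0_iff)
  also have "\<dots> \<longleftrightarrow> x = 0"
    by (subst sum_nonneg_eq_0_iff) (auto simp: vec_eq_iff)
  finally show ?thesis .
qed

lemma unit_nonzero: "cin x x = 1 \<Longrightarrow> x \<noteq> 0"
  by auto

lemma exists_normalize:
  assumes "x \<noteq> 0"
  obtains c where "c \<noteq> 0" "cin (c *s x) (c *s x) = 1"
proof -
  define r where "r = (\<Sum>i\<in>UNIV. (cmod (x $ i))\<^sup>2)"
  have r: "cin x x = of_real r"
    by (simp only: cin_self r_def)
  have "r \<noteq> 0"
    using assms r cin_self_eq0[of x] by auto
  moreover have "r \<ge> 0"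
    by (simp add: r_def sum_nonneg)
  ultimately have "r > 0" by simp
  define c where "c = complex_of_real (1 / sqrt r)"
  have "cin (c *s x) (c *s x) = of_real ((1 / sqrt r) * (1 / sqrt r) * r)"
    unfolding cin_scale_left cin_scale_right r c_def complex_cnj_complex_of_real of_real_mult
    by (simp only: mult_ac)
  also have "(1 / sqrt r) * (1 / sqrt r) * r = 1"
    using \<open>r > 0\<close> by (simp add: field_simps)
  finally show ?thesis
    using that[of c] \<open>r > 0\<close> by (simp add: c_def)
qed

lemma cin_eqI:
  assumes "\<And>x. cin x y = cin x z"
  shows "y = z"
proof -
  have "cin (y - z) (y - z) = 0"
    by (simp only: cin_diff_right assms) simp
  thus ?thesis by (simp add: cin_self_eq0)
qed

lemma cin_axis: "cin (axis k 1) x = x $ k"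
proof -
  have "cin (axis k 1) x = (\<Sum>i\<in>UNIV. if i = k then x $ i else 0)"
    unfolding cin_def axis_def by (intro sum.cong) auto
  thus ?thesis by simp
qed

lemma cin_adjoint: "cin x (A *v y) = cin (ct A *v x) y"
  unfolding cin_def ct_def matrix_vector_mult_def
  by (simp add: sum_distrib_left sum_distrib_right mult_ac) (rule sum.swap)

lemma ct_ct [simp]: "ct (ct A) = A"
  by (simp add: ct_def vec_eq_iff)

lemma cin_adjoint': "cin (A *v x) y = cin x (ct A *v y)"
  by (simp add: cin_adjoint)

lemma ct_mult: "ct (A ** B) = ct B ** ct A"
  by (simp add: ct_def matrix_matrix_mult_def vec_eq_iff mult_ac)

lemma ct_add: "ct (A + B) = ct A + ct B"
  by (simp add: ct_def vec_eq_iff)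

lemma ct_diff: "ct (A - B) = ct A - ct B"
  by (simp add: ct_def vec_eq_iff)

lemma ct_zero [simp]: "ct 0 = 0"
  by (simp add: ct_def vec_eq_iff)

lemma ct_mat1 [simp]: "ct (mat 1) = mat 1"
  by (simp add: ct_def vec_eq_iff mat_def)

lemma ct_sum: "ct (sum f S) = (\<Sum>s\<in>S. ct (f s))"
  by (induction S rule: infinite_finite_induct) (simp_all add: ct_add)

lemma ct_outer [simp]: "ct (outer x y) = outer y x"
  by (simp add: ct_def outer_def vec_eq_iff)

lemma outer_mult_vec [simp]: "outer x y *v z = cin y z *s x"
  by (simp add: outer_def matrix_vector_mult_def cin_def vec_eq_iff sum_distrib_left mult_ac)

lemma matrix_mult_scale [simp]: "A *v (c *s x) = c *s (A *v x)" for A :: "complex^'n^'m"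
  by (simp add: matrix_vector_mult_def vec_eq_iff sum_distrib_left mult_ac)

lemma matrix_vec_eqI: "(\<And>x. A *v x = B *v x) \<Longrightarrow> A = B" for A :: "complex^'n^'m"
  by (simp add: matrix_eq)

lemma mult_vec_assoc: "(A ** B) *v x = A *v (B *v x)" for A :: "complex^'n^'m"
  by (simp add: matrix_vector_mul_assoc)

lemma sum_mult_vec: "sum f S *v x = (\<Sum>s\<in>S. f s *v x)" for x :: "complex^'n"
  by (induction S rule: infinite_finite_induct) (simp_all add: matrix_vector_mult_add_rdistrib)

lemma mult_vec_sum: "A *v sum f S = (\<Sum>s\<in>S. A *v f s)" for A :: "complex^'n^'m"
  by (induction S rule: infinite_finite_induct) (simp_all add: matrix_vector_right_distrib)

lemma matrix_mult_sum_left: "sum f S ** B = (\<Sum>s\<in>S. f s ** B)" for B :: "complex^'n^'m"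
  by (rule matrix_vec_eqI) (simp add: mult_vec_assoc sum_mult_vec)

lemma matrix_mult_sum_right: "A ** sum f S = (\<Sum>s\<in>S. A ** f s)" for A :: "complex^'n^'m"
  by (rule matrix_vec_eqI) (simp add: mult_vec_assoc sum_mult_vec mult_vec_sum)

lemma matrix_mult_diff_left: "(A - B) ** C = A ** C - B ** C" for A :: "complex^'n^'m"
  by (rule matrix_vec_eqI) (simp add: mult_vec_assoc matrix_vector_mult_diff_rdistrib)

lemma matrix_mult_diff_right: "A ** (B - C) = A ** B - A ** C" for A :: "complex^'n^'m"
  by (rule matrix_vec_eqI) (simp add: mult_vec_assoc matrix_vector_mult_diff_rdistrib
      matrix_vector_mult_diff_distrib)

lemma mult_outer: "A ** outer x y = outer (A *v x) y"
  by (rule matrix_vec_eqI) (simp add: mult_vec_assoc)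

lemma outer_mult: "outer x y ** A = outer x (ct A *v y)"
  by (rule matrix_vec_eqI) (simp add: mult_vec_assoc cin_adjoint)

lemma outer_scale_left: "outer (c *s x) y = cscale c (outer x y)"
  by (simp add: outer_def cscale_def vec_eq_iff)

lemma outer_add_left: "outer (x + y) z = outer x z + outer y z"
  by (simp add: outer_def vec_eq_iff algebra_simps)

lemma outer_zero [simp]: "outer 0 y = 0" "outer x 0 = 0"
  by (simp_all add: outer_def vec_eq_iff)

lemma outer_nonzero: "x \<noteq> 0 \<Longrightarrow> y \<noteq> 0 \<Longrightarrow> outer x y \<noteq> 0"
  by (auto simp: outer_def vec_eq_iff)

lemma cscale_mult_vec: "cscale c A *v x = c *s (A *v x)"
  by (simp add: cscale_def matrix_vector_mult_def vec_eq_iff sum_distrib_left mult_ac)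

lemma ct_cscale: "ct (cscale c A) = cscale (cnj c) (ct A)"
  by (simp add: ct_def cscale_def vec_eq_iff)

lemma cscale_cscale: "cscale c (cscale d A) = cscale (c * d) A"
  by (simp add: cscale_def vec_eq_iff)

lemma cscale_1 [simp]: "cscale 1 A = A"
  by (simp add: cscale_def vec_eq_iff)

text \<open>Writes 1 as a sum of rank one projections, so that the value of a
  \<open>star_hom\<close> at 1 can be computed from its values on such projections.\<close>

lemma sum_outer_axis: "(\<Sum>k\<in>UNIV. outer (axis k 1) (axis k 1)) = mat 1"
proof (rule matrix_vec_eqI)
  fix x :: "complex^'n"
  show "(\<Sum>k\<in>UNIV. outer (axis k 1) (axis k 1)) *v x = mat 1 *v x"
    by (simp add: sum_mult_vec cin_axis basis_expansion)
qed

lemma isometry_ctI: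
  assumes "\<And>x y. cin (U *v x) (U *v y) = cin x y"
  shows "ct U ** U = mat 1"
  by (rule matrix_vec_eqI, rule cin_eqI) (simp add: mult_vec_assoc assms flip: cin_adjoint')

section \<open>Matrices of rank one\<close>

lemma outer_rows: "rows (outer x y) = range (\<lambda>i. x $ i *s (\<chi> j. cnj (y $ j)))"
  by (auto simp: rows_def row_def outer_def vec_eq_iff)

lemma rank_outer:
  assumes "x \<noteq> 0" "y \<noteq> 0"
  shows "rank (outer x y) = 1"
proof -
  define w :: "complex^'b" where "w = (\<chi> j. cnj (y $ j))"
  have w: "w \<noteq> 0"
    using assms(2) by (auto simp: w_def vec_eq_iff)
  obtain i where i: "x $ i \<noteq> 0"
    using assms(1) by (auto simp: vec_eq_iff)
  have rows: "rows (outer x y) = range (\<lambda>i. x $ i *s w)"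
    by (simp add: outer_rows w_def)
  have "w = (1 / x $ i) *s (x $ i *s w)"
    using i by (simp add: vector_smult_assoc)
  hence "w \<in> vec.span (rows (outer x y))"
    unfolding rows by (metis rangeI vec.span_base vec.span_scale)
  hence "vec.dim {w} \<le> vec.dim (rows (outer x y))"
    by (intro vec.dim_mono) auto
  moreover have "vec.dim (rows (outer x y)) \<le> vec.dim {w}"
    by (intro vec.dim_mono) (auto simp: rows vec.span_base vec.span_scale)
  moreover have "vec.dim {w} = 1"
    using w by (subst vec.dim_eq_card_independent) auto
  ultimately show ?thesis
    by (simp add: row_rank_def_gen)
qed

text \<open>The row space is spanned by a single vector w; the coefficients of the rows along w form
  the left factor, and the conjugate of w the right one.\<close>

lemma rank_one_outer:
  fixes A :: "complex^'n^'m"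
  assumes "rank A = 1"
  obtains x y where "A = outer x y"
proof -
  obtain B where B: "B \<subseteq> rows A" "rows A \<subseteq> vec.span B" "card B = vec.dim (rows A)"
    using vec.basis_exists[of "rows A"] by metis
  then obtain w where w: "B = {w}"
    using assms by (auto simp: row_rank_def_gen card_1_singleton_iff)
  have "\<exists>c. A $ i = c *s w" for i
  proof -
    have "row i A \<in> vec.span {w}"
      using B w by (auto simp: rows_def)
    thus ?thesis
      by (auto simp: vec.span_singleton row_def)
  qed
  then obtain c where "\<And>i. A $ i = c i *s w" by metis
  hence "A = outer (\<chi> i. c i) (\<chi> j. cnj (w $ j))"
    by (simp add: outer_def vec_eq_iff)
  thus ?thesis by (rule that)
qed

lemma projection_iff: "projection p \<longleftrightarrow> p ** p = p \<and> ct p = p"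
  by (simp add: projection_def adj_eq_ct)

lemma projection_unit_vector:
  assumes "projection p" "p \<noteq> 0"
  obtains x where "p *v x = x" "cin x x = 1"
proof -
  obtain z where z: "p *v z \<noteq> 0"
    using assms(2) by (auto simp: matrix_eq)
  obtain c where c: "cin (c *s (p *v z)) (c *s (p *v z)) = 1"
    by (rule exists_normalize[OF z])
  have "p *v (c *s (p *v z)) = c *s (p *v z)"
    using assms(1) by (simp add: projection_iff matrix_vector_mul_assoc)
  thus ?thesis using c that by blast
qed

lemma projection_outer: "cin x x = 1 \<Longrightarrow> projection (outer x x)"
  by (simp add: projection_iff mult_outer)

text \<open>The range of p is the line through a unit fixed vector x, and self-adjointness forces
  the coefficient of p z along x to be \<open>cin x z\<close>.\<close>

lemma rank_one_projection:
  assumes "projection p" "rank p = 1"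
  obtains x where "cin x x = 1" "p = outer x x"
proof -
  obtain u v where uv: "p = outer u v"
    using rank_one_outer[OF assms(2)] by metis
  have "p \<noteq> 0"
    using assms(2) by (auto simp: row_rank_def_gen rows_def row_def)
  then obtain x where x: "p *v x = x" "cin x x = 1"
    using projection_unit_vector[OF assms(1)] by metis
  have xu: "x = cin v x *s u"
    using x(1) uv by simp
  have "p *v z = cin x z *s x" for z
  proof -
    have "cin v x \<noteq> 0"
      using x xu by auto
    hence "u = (1 / cin v x) *s x"
      by (subst xu) (simp add: vector_smult_assoc)
    then obtain d where d: "p *v z = d *s x"
      using uv by (metis outer_mult_vec vector_smult_assoc)
    have "cin x (p *v z) = cin x z"
      using assms(1) x(1) by (simp add: cin_adjoint projection_iff)
    thus ?thesis using d x(2) by simp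
  qed
  hence "p = outer x x"
    by (intro matrix_vec_eqI) simp
  thus ?thesis using x(2) that by blast
qed

text \<open>The place where the rank condition on atoms turns into vectors. No dimension is counted:
  p differs from the rank one projection \<open>outer x x\<close>, so some p z lies off the line of
  x, and one Gram-Schmidt step gives y.\<close>

lemma projection_two_unit_vectors:
  assumes "projection p" "p \<noteq> 0" "rank p \<noteq> 1"
  obtains x y where "p *v x = x" "p *v y = y" "cin x x = 1" "cin y y = 1" "cin x y = 0"
proof -
  obtain x where x: "p *v x = x" "cin x x = 1"
    using projection_unit_vector[OF assms(1,2)] by metis
  have "p \<noteq> outer x x"
    using assms(3) x(2) by (metis rank_outer unit_nonzero)
  then obtain z where z: "p *v z \<noteq> cin x z *s x"
    by (auto simp: matrix_eq)
  define y where "y = p *v z - cin x z *s x"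
  have py: "p *v y = y"
    using assms(1) x by (simp add: y_def algebra_simps matrix_vector_mul_assoc projection_iff)
  have xy: "cin x y = 0"
    using assms(1) x by (simp add: y_def cin_diff_right cin_adjoint projection_iff)
  obtain c where "cin (c *s y) (c *s y) = 1"
    by (rule exists_normalize[of y]) (use z in \<open>auto simp: y_def\<close>)
  thus ?thesis
    using that[of x "c *s y"] x py xy by simp
qed

section \<open>Multiplicity one homomorphisms\<close>

lemma star_hom_sum:
  assumes "star_hom \<pi>"
  shows "\<pi> (sum f S) = (\<Sum>s\<in>S. \<pi> (f s))"
proof -
  have add: "\<pi> (a + b) = \<pi> a + \<pi> b" for a b
    using assms by (simp add: star_hom_def)
  have "\<pi> 0 = 0"
    using add[of 0 0] by simp
  thus ?thesis
    by (induction S rule: infinite_finite_induct) (simp_all add: add)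
qed

text \<open>The vector \<xi> spans the range of the image of one rank one projection
  \<open>outer e e\<close>, and U sends x to \<pi> (outer x e) \<xi>. It is isometric because the
  adjoint of \<open>outer x e\<close> times \<open>outer y e\<close> is \<open>cin x y\<close> times
  \<open>outer e e\<close>, and it intertwines a with \<pi> a because a ** outer x e = outer (a x)
  e.\<close>

lemma star_hom_isometry:
  fixes \<pi> :: "complex^'n^'n \<Rightarrow> complex^'m^'m"
  assumes hom: "star_hom \<pi>"
    and rk: "\<And>p. projection p \<Longrightarrow> rank p = 1 \<Longrightarrow> projection (\<pi> p) \<and> rank (\<pi> p) = 1"
  obtains U :: "complex^'n^'m" where "ct U ** U = mat 1" "\<And>a. \<pi> a = U ** a ** ct U"
proof -
  have add: "\<pi> (a + b) = \<pi> a + \<pi> b" and mult: "\<pi> (a ** b) = \<pi> a ** \<pi> b"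
    and scale: "\<pi> (cscale c a) = cscale c (\<pi> a)" and star: "\<pi> (ct a) = ct (\<pi> a)" for a b c
    using hom by (simp_all add: star_hom_def adj_eq_ct)
  obtain k :: 'n where True by simp
  define e :: "complex^'n" where "e = axis k 1"
  have e: "cin e e = 1"
    by (simp add: e_def cin_axis)
  obtain \<xi> where \<xi>: "cin \<xi> \<xi> = 1" "\<pi> (outer e e) = outer \<xi> \<xi>"
    using rk[OF projection_outer[OF e]] rank_outer[of e e] e rank_one_projection
    by (metis unit_nonzero)
  define f where "f x = \<pi> (outer x e) *v \<xi>" for x
  define U where "U = matrix f"
  have "Vector_Spaces.linear (*s) (*s) f"
    by (unfold_locales) (simp_all add: f_def outer_add_left add outer_scale_left scale
        cscale_mult_vec matrix_vector_mult_add_rdistrib)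
  hence Ux: "U *v x = f x" for x
    by (simp add: U_def matrix_works)
  have cin_f: "cin (f x) (f y) = cin x y" for x y
  proof -
    have "cin (f x) (f y) = cin \<xi> (ct (\<pi> (outer x e)) ** \<pi> (outer y e) *v \<xi>)"
      by (simp add: f_def cin_adjoint' mult_vec_assoc)
    also have "ct (\<pi> (outer x e)) ** \<pi> (outer y e) = cscale (cin x y) (outer \<xi> \<xi>)"
      by (simp add: mult_outer \<xi> outer_scale_left scale flip: star mult)
    finally show ?thesis
      using \<xi>(1) by (simp add: cscale_mult_vec)
  qed
  have iso: "ct U ** U = mat 1"
    by (rule isometry_ctI) (simp add: Ux cin_f)
  have inter: "\<pi> a ** U = U ** a" for a
  proof (rule matrix_vec_eqI)
    fix x
    have "\<pi> (outer (a *v x) e) = \<pi> a ** \<pi> (outer x e)"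
      by (simp only: mult flip: mult_outer)
    thus "(\<pi> a ** U) *v x = (U ** a) *v x"
      by (simp add: mult_vec_assoc Ux f_def)
  qed
  have outer: "\<pi> (outer x x) = outer (U *v x) (U *v x)" for x
  proof -
    \<comment> \<open>Passing through \<open>outer e e\<close> brings in \<xi>, and hence U
      x.\<close>
    have "outer x x = outer x e ** outer e e ** ct (outer x e)"
      using e by (simp add: mult_outer)
    hence "\<pi> (outer x x) = \<pi> (outer x e) ** outer \<xi> \<xi> ** ct (\<pi> (outer x e))"
      by (simp only: mult star \<xi>)
    thus ?thesis
      by (simp add: mult_outer outer_mult Ux f_def)
  qed
  \<comment> \<open>\<pi> need not be unital. Intertwining determines \<pi> a on the range of U
    only; this equation shows that \<pi> a vanishes on the orthogonal complement of that
    range.\<close>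
  have "\<pi> (mat 1) = U ** ct U"
  proof -
    have "\<pi> (mat 1) = (\<Sum>k\<in>UNIV. \<pi> (outer (axis k 1) (axis k 1)))"
      by (simp only: star_hom_sum[OF hom] flip: sum_outer_axis)
    also have "\<dots> = (\<Sum>k\<in>UNIV. U ** outer (axis k 1) (axis k 1) ** ct U)"
      by (simp add: outer mult_outer outer_mult)
    also have "\<dots> = U ** (\<Sum>k\<in>UNIV. outer (axis k 1) (axis k 1)) ** ct U"
      by (simp add: matrix_mult_sum_left matrix_mult_sum_right)
    also have "\<dots> = U ** ct U"
      by (simp only: sum_outer_axis matrix_mul_rid)
    finally show ?thesis .
  qed
  hence "\<pi> a = U ** a ** ct U" for a
    using mult[of a "mat 1"] inter[of a] by (simp add: matrix_mul_assoc)
  thus ?thesis using iso that by blast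
qed

section \<open>Nest algebras and adapted orthonormal bases\<close>

lemma nest_atom_projection:
  assumes "nest_atoms qs" "i < length qs"
  shows "ct (qs ! i) = qs ! i" "qs ! i ** qs ! i = qs ! i" "qs ! i \<noteq> 0" "projection (qs ! i)"
  using assms by (auto simp: nest_atoms_def projection_iff)

lemma nest_atom_mult:
  assumes "nest_atoms qs" "i < length qs" "j < length qs"
  shows "qs ! i ** qs ! j = (if i = j then qs ! i else 0)"
  using assms by (auto simp: nest_atoms_def projection_iff)

lemma nest_atom_mult_vec:
  assumes "nest_atoms qs" "i < length qs" "j < length qs"
  shows "qs ! i *v (qs ! j *v x) = (if i = j then qs ! i *v x else 0)"
  using nest_atom_mult[OF assms] by (simp add: matrix_vector_mul_assoc)

lemma nest_atom_vec:
  assumes "nest_atoms qs" "i < length qs" "j < length qs" "qs ! j *v x = x"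
  shows "qs ! i *v x = (if i = j then x else 0)"
  using nest_atom_mult_vec[OF assms(1-3), of x] assms(4) by auto

lemma nest_atoms_cin:
  assumes "nest_atoms qs" "i < length qs" "j < length qs" "i \<noteq> j" "qs ! i *v x = x" "qs ! j *v y = y"
  shows "cin x y = 0"
proof -
  have "cin x y = cin x (qs ! i *v y)"
    using nest_atom_projection(1)[OF assms(1,2)] assms(5) by (simp add: cin_adjoint)
  thus ?thesis
    using nest_atom_vec[OF assms(1-3,6)] assms(4) by simp
qed

lemma nest_atoms_sum:
  assumes "nest_atoms qs"
  shows "(\<Sum>i<length qs. qs ! i) = mat 1"
  using assms by (simp add: nest_atoms_def sum_list_sum_nth atLeast0LessThan)

lemma nest_atoms_sum_vec:
  assumes "nest_atoms qs"
  shows "(\<Sum>i<length qs. qs ! i *v x) = x"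
  using nest_atoms_sum[OF assms] by (simp flip: sum_mult_vec)

lemma nest_atoms_nonempty:
  fixes qs :: "(complex^'n^'n) list"
  assumes "nest_atoms qs"
  shows "0 < length qs"
proof (rule ccontr)
  assume "\<not> 0 < length qs"
  hence "mat 1 = (0 :: complex^'n^'n)"
    using assms by (simp add: nest_atoms_def)
  hence "mat 1 *v axis k 1 = (0 :: complex^'n)" for k
    by (metis matrix_vector_mult_0)
  thus False
    by simp
qed

text \<open>With F_i the sum of the atoms before position i, the atom i lies under 1 - F_i and every
  atom j < i under F_i, so the corner condition at i kills the block (i,j). Conversely each corner
  is a sum of blocks below the diagonal.\<close>

lemma nest_alg_iff:
  assumes "nest_atoms qs"
  shows "a \<in> nest_alg qs \<longleftrightarrow> (\<forall>i<length qs. \<forall>j<i. qs ! i ** a ** qs ! j = 0)"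
proof -
  define F where "F k = (\<Sum>i<k. qs ! i)" for k
  have F: "sum_list (take k qs) = F k" if "k \<le> length qs" for k
    using that by (simp add: sum_list_sum_nth atLeast0LessThan F_def)
  have G: "mat 1 - F k = (\<Sum>i\<in>{k..<length qs}. qs ! i)" if "k \<le> length qs" for k
    using sum.atLeastLessThan_concat[of 0 k "length qs" "(!) qs"] nest_atoms_sum[OF assms] that
    by (simp add: F_def atLeast0LessThan algebra_simps)
  show ?thesis
  proof
    assume a: "a \<in> nest_alg qs"
    show "\<forall>i<length qs. \<forall>j<i. qs ! i ** a ** qs ! j = 0"
    proof (intro allI impI)
      fix i j assume ij: "i < length qs" "j < i"
      have "qs ! i ** F i = 0"
        using ij by (auto simp: F_def matrix_mult_sum_right nest_atom_mult[OF assms] intro!: sum.neutral)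
      hence 1: "qs ! i ** (mat 1 - F i) = qs ! i"
        by (simp add: matrix_mult_diff_right)
      have "F i ** qs ! j = (\<Sum>k<i. if k = j then qs ! j else 0)"
        using ij by (auto simp: F_def matrix_mult_sum_left nest_atom_mult[OF assms] intro!: sum.cong)
      hence 2: "F i ** qs ! j = qs ! j"
        using ij by simp
      have "(mat 1 - F i) ** a ** F i = 0"
        unfolding F[OF less_imp_le[OF ij(1)], symmetric]
        using a ij by (simp add: nest_alg_def)
      hence "(qs ! i ** (mat 1 - F i)) ** a ** (F i ** qs ! j) = 0"
        by (simp flip: matrix_mul_assoc) (simp add: matrix_mul_assoc)
      thus "qs ! i ** a ** qs ! j = 0"
        by (simp only: 1 2)
    qed
  next
    assume z: "\<forall>i<length qs. \<forall>j<i. qs ! i ** a ** qs ! j = 0"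
    have "(mat 1 - F k) ** a ** F k = 0" if "k \<le> length qs" for k
      unfolding G[OF that] unfolding F_def matrix_mult_sum_left matrix_mult_sum_right
      using z by (intro sum.neutral ballI) auto
    thus "a \<in> nest_alg qs"
      using F by (auto simp: nest_alg_def)
  qed
qed

lemma mat1_in_nest_alg: "nest_atoms qs \<Longrightarrow> mat 1 \<in> nest_alg qs"
  by (auto simp: nest_alg_iff nest_atom_mult)

lemma matrix_mult_add_left: "(A + B) ** C = A ** C + B ** C" for A :: "complex^'n^'m"
  by (rule matrix_vec_eqI) (simp add: mult_vec_assoc matrix_vector_mult_add_rdistrib)

lemma nest_alg_add: "nest_atoms qs \<Longrightarrow> a \<in> nest_alg qs \<Longrightarrow> b \<in> nest_alg qs \<Longrightarrow> a + b \<in> nest_alg qs"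
  by (auto simp: nest_alg_iff matrix_add_ldistrib matrix_mult_add_left)

lemma zero_in_nest_alg: "nest_atoms qs \<Longrightarrow> 0 \<in> nest_alg qs"
  by (simp add: nest_alg_iff)

lemma nest_alg_sum:
  "nest_atoms qs \<Longrightarrow> (\<And>s. s \<in> S \<Longrightarrow> f s \<in> nest_alg qs) \<Longrightarrow> sum f S \<in> nest_alg qs"
  by (induction S rule: infinite_finite_induct) (auto simp: zero_in_nest_alg nest_alg_add)

lemma cscale_mult_left: "cscale c a ** b = cscale c (a ** b)"
  by (rule matrix_vec_eqI) (simp add: mult_vec_assoc cscale_mult_vec)

lemma cscale_mult_right: "a ** cscale c b = cscale c (a ** b)"
  by (rule matrix_vec_eqI) (simp add: mult_vec_assoc cscale_mult_vec)

lemma cscale_zero [simp]: "cscale c 0 = 0"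
  by (simp add: cscale_def vec_eq_iff)

lemma nest_alg_cscale: "nest_atoms qs \<Longrightarrow> a \<in> nest_alg qs \<Longrightarrow> cscale c a \<in> nest_alg qs"
  by (auto simp: nest_alg_iff cscale_mult_left cscale_mult_right)

lemma nest_alg_mult:
  assumes "nest_atoms qs" "a \<in> nest_alg qs" "b \<in> nest_alg qs"
  shows "a ** b \<in> nest_alg qs"
  unfolding nest_alg_iff[OF assms(1)]
proof (intro allI impI)
  fix i j assume ij: "i < length qs" "j < i"
  have "qs ! i ** (a ** b) ** qs ! j = qs ! i ** a ** (\<Sum>k<length qs. qs ! k ** qs ! k) ** b ** qs ! j"
    using nest_atoms_sum[OF assms(1)]
    by (simp add: nest_atom_mult[OF assms(1)] matrix_mul_assoc)
  also have "\<dots> = (\<Sum>k<length qs. (qs ! i ** a ** qs ! k) ** (qs ! k ** b ** qs ! j))"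
    by (simp add: matrix_mult_sum_left matrix_mult_sum_right matrix_mul_assoc)
  also have "\<dots> = 0"
  proof (intro sum.neutral ballI)
    fix k assume "k \<in> {..<length qs}"
    \<comment> \<open>For any intermediate atom k one of the two factors is a block strictly below
      the diagonal.\<close>
    moreover have "k < i \<or> j < k"
      using ij by linarith
    ultimately show "(qs ! i ** a ** qs ! k) ** (qs ! k ** b ** qs ! j) = 0"
      using assms ij by (auto simp: nest_alg_iff)
  qed
  finally show "qs ! i ** (a ** b) ** qs ! j = 0" .
qed

lemma outer_in_nest_alg:
  assumes "nest_atoms qs" "s \<le> t" "t < length qs" "qs ! s *v x = x" "qs ! t *v y = y"
  shows "outer x y \<in> nest_alg qs"
  unfolding nest_alg_iff[OF assms(1)]
proof (intro allI impI)
  fix i j assume ij: "i < length qs" "j < i"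
  have "qs ! i ** outer x y ** qs ! j = outer (qs ! i *v x) (qs ! j *v y)"
    using ij nest_atom_projection(1)[OF assms(1), of j] by (simp add: mult_outer outer_mult)
  moreover have "qs ! i *v x = (if i = s then x else 0)" "qs ! j *v y = (if j = t then y else 0)"
    using ij assms(2,3) nest_atom_vec[OF assms(1) _ _ assms(4), of i]
      nest_atom_vec[OF assms(1) _ _ assms(5), of j] by simp_all
  ultimately show "qs ! i ** outer x y ** qs ! j = 0"
    using assms(2) ij by auto
qed

text \<open>Orthonormal bases are lists because their order gives the nest of a copy of $T_n$.\<close>

definition onb :: "(complex^'n) list \<Rightarrow> bool" where
  "onb xs \<longleftrightarrow>
     (\<forall>i<length xs. \<forall>j<length xs. cin (xs ! i) (xs ! j) = (if i = j then 1 else 0)) \<and>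
     (\<Sum>i<length xs. outer (xs ! i) (xs ! i)) = mat 1"

definition vector_atoms :: "(complex^'n) list \<Rightarrow> (complex^'n^'n) list" where
  "vector_atoms xs = map (\<lambda>x. outer x x) xs"

lemma length_vector_atoms [simp]: "length (vector_atoms xs) = length xs"
  by (simp add: vector_atoms_def)

lemma nth_vector_atoms [simp]: "i < length xs \<Longrightarrow> vector_atoms xs ! i = outer (xs ! i) (xs ! i)"
  by (simp add: vector_atoms_def)

lemma onb_cin:
  "onb xs \<Longrightarrow> i < length xs \<Longrightarrow> j < length xs \<Longrightarrow> cin (xs ! i) (xs ! j) = (if i = j then 1 else 0)"
  by (simp add: onb_def)

lemma onb_expand:
  assumes "onb xs"
  shows "(\<Sum>i<length xs. cin (xs ! i) y *s xs ! i) = y"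
proof -
  have "(\<Sum>i<length xs. outer (xs ! i) (xs ! i)) *v y = y"
    using assms by (simp add: onb_def)
  thus ?thesis by (simp add: sum_mult_vec)
qed

lemma onb_vec_eqI:
  assumes "onb xs" "\<And>i. i < length xs \<Longrightarrow> cin (xs ! i) y = cin (xs ! i) z"
  shows "y = z"
  by (subst (1 2) onb_expand[OF assms(1), symmetric]) (simp add: assms(2))

lemma onb_matrix_eqI:
  assumes "onb xs" "onb ys"
    "\<And>i j. i < length ys \<Longrightarrow> j < length xs \<Longrightarrow> cin (ys ! i) (A *v xs ! j) = cin (ys ! i) (B *v xs ! j)"
  shows "A = B"
proof (rule matrix_vec_eqI)
  fix z
  have "A *v (\<Sum>i<length xs. cin (xs ! i) z *s xs ! i) = B *v (\<Sum>i<length xs. cin (xs ! i) z *s xs ! i)"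
    unfolding mult_vec_sum matrix_mult_scale
    by (intro sum.cong refl arg_cong2[where f = "(*s)"] onb_vec_eqI[OF assms(2)]) (use assms(3) in auto)
  thus "A *v z = B *v z"
    by (simp add: onb_expand[OF assms(1)])
qed

lemma onb_rank_one_atoms:
  assumes "onb xs"
  shows "rank_one_atoms (vector_atoms xs)"
proof -
  have "projection (outer (xs ! i) (xs ! i)) \<and> outer (xs ! i) (xs ! i) \<noteq> 0 \<and>
      rank (outer (xs ! i) (xs ! i)) = 1" if "i < length xs" for i
  proof -
    have "cin (xs ! i) (xs ! i) = 1"
      by (simp add: onb_cin[OF assms that that])
    thus ?thesis
      using rank_outer outer_nonzero projection_outer unit_nonzero by blast
  qed
  moreover have "sum_list (vector_atoms xs) = mat 1"
    using assms by (simp add: onb_def sum_list_sum_nth atLeast0LessThan)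
  ultimately show ?thesis
    using onb_cin[OF assms]
    by (auto simp: rank_one_atoms_def nest_atoms_def in_set_conv_nth mult_outer)
qed

section \<open>Upper triangular matrices relative to an orthonormal basis\<close>

lemma vector_atoms_block:
  assumes "i < length xs" "j < length xs"
  shows "vector_atoms xs ! i ** a ** vector_atoms xs ! j
    = cscale (cin (xs ! i) (a *v xs ! j)) (outer (xs ! i) (xs ! j))"
  using assms by (intro matrix_vec_eqI) (simp add: mult_vec_assoc cscale_mult_vec mult_ac vector_smult_assoc)

lemma vector_atoms_block_eq0:
  assumes "onb xs" "i < length xs" "j < length xs"
  shows "vector_atoms xs ! i ** a ** vector_atoms xs ! j = 0 \<longleftrightarrow> cin (xs ! i) (a *v xs ! j) = 0"
proof -
  have "xs ! i \<noteq> 0" "xs ! j \<noteq> 0"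
    using onb_cin[OF assms(1)] assms(2,3) unit_nonzero by metis+
  hence "outer (xs ! i) (xs ! j) \<noteq> 0"
    by (rule outer_nonzero)
  thus ?thesis
    unfolding vector_atoms_block[OF assms(2,3)] by (auto simp: cscale_def vec_eq_iff)
qed

lemma nest_alg_vector_atoms:
  assumes "onb xs"
  shows "a \<in> nest_alg (vector_atoms xs) \<longleftrightarrow>
    (\<forall>i<length xs. \<forall>j<i. cin (xs ! i) (a *v xs ! j) = 0)"
proof -
  have "nest_atoms (vector_atoms xs)"
    using onb_rank_one_atoms[OF assms] by (simp add: rank_one_atoms_def)
  thus ?thesis
    using vector_atoms_block_eq0[OF assms] by (force simp: nest_alg_iff simp del: nth_vector_atoms)
qed

lemma outer_in_nest_alg_vector_atoms:
  assumes "onb xs" "i \<le> j" "j < length xs"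
  shows "outer (xs ! i) (xs ! j) \<in> nest_alg (vector_atoms xs)"
  using assms by (auto simp: nest_alg_vector_atoms onb_cin)

text \<open>If a matrix and its adjoint are both upper triangular, every basis vector is an
  eigenvector; any two such matrices are diagonal in the same basis and commute.\<close>

lemma vector_atoms_triangular:
  assumes "onb xs"
  shows "triangular (nest_alg (vector_atoms xs))"
proof -
  let ?T = "nest_alg (vector_atoms xs)"
  have nest: "nest_atoms (vector_atoms xs)"
    using onb_rank_one_atoms[OF assms] by (simp add: rank_one_atoms_def)
  have diag: "a *v xs ! j = cin (xs ! j) (a *v xs ! j) *s xs ! j"
    if "a \<in> ?T" "ct a \<in> ?T" "j < length xs" for a j
  proof (rule onb_vec_eqI[OF assms])
    fix i assume i: "i < length xs"
    consider "i = j" | "j < i" | "i < j" by linarith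
    thus "cin (xs ! i) (a *v xs ! j) = cin (xs ! i) (cin (xs ! j) (a *v xs ! j) *s xs ! j)"
    proof cases
      case 3
      hence "cin (xs ! j) (ct a *v xs ! i) = 0"
        using that i by (simp add: nest_alg_vector_atoms[OF assms])
      hence "cin (xs ! i) (a *v xs ! j) = 0"
        by (subst cin_adjoint) (simp add: cin_eq0_commute)
      thus ?thesis
        using i 3 that by (simp add: onb_cin[OF assms])
    qed (use i that in \<open>simp_all add: onb_cin[OF assms] nest_alg_vector_atoms[OF assms]\<close>)
  qed
  have "a ** b = b ** a" if ab: "a \<in> ?T" "b \<in> ?T" "ct a \<in> ?T" "ct b \<in> ?T" for a b
  proof (rule onb_matrix_eqI[OF assms assms])
    fix i j assume j: "j < length xs"
    obtain \<alpha> \<beta> where "a *v xs ! j = \<alpha> *s xs ! j" "b *v xs ! j = \<beta> *s xs ! j"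
      using diag ab j by metis
    thus "cin (xs ! i) (a ** b *v xs ! j) = cin (xs ! i) (b ** a *v xs ! j)"
      by (simp add: mult_vec_assoc)
  qed
  thus ?thesis
    using nest
    by (simp add: triangular_def subalgebra_def adj_eq_ct mat1_in_nest_alg nest_alg_add
        nest_alg_mult nest_alg_cscale)
qed

text \<open>A block below the diagonal involves only entries below the diagonal, as
  \<open>blk\<close> is nondecreasing; this gives the inclusion. For maximality, a nonzero entry
  (i,j) with j < i of some a in S can be cut out by diagonal matrix units, so the matrix unit (i,j)
  lies in S along with its adjoint. The two do not commute.\<close>

lemma vector_atoms_maximal_triangular:
  assumes nest: "nest_atoms qs" and xs: "onb xs"
    and blk: "\<And>i. i < length xs \<Longrightarrow> blk i < length qs \<and> qs ! blk i *v xs ! i = xs ! i"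
    and mono: "\<And>i j. i \<le> j \<Longrightarrow> j < length xs \<Longrightarrow> blk i \<le> blk j"
  shows "maximal_triangular_in (nest_alg (vector_atoms xs)) (nest_alg qs)"
proof -
  let ?T = "nest_alg (vector_atoms xs)"
  have "?T \<subseteq> nest_alg qs"
  proof
    fix a assume a: "a \<in> ?T"
    have "qs ! s ** a ** qs ! t = 0" if st: "s < length qs" "t < s" for s t
    proof (rule onb_matrix_eqI[OF xs xs])
      fix i j assume ij: "i < length xs" "j < length xs"
      have "cin (xs ! i) (qs ! s ** a ** qs ! t *v xs ! j) = cin (qs ! s *v xs ! i) (a *v (qs ! t *v xs ! j))"
        using st nest_atom_projection(1)[OF nest, of s]
        by (simp add: mult_vec_assoc cin_adjoint[of _ "qs ! s"])
      also have "\<dots> = 0"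
      proof (cases "blk i = s \<and> blk j = t")
        case True
        hence "j < i"
          using mono[of i j] ij st by (meson leD leI)
        moreover have "qs ! s *v xs ! i = xs ! i" "qs ! t *v xs ! j = xs ! j"
          using blk ij True by auto
        ultimately show ?thesis
          using a ij by (simp add: nest_alg_vector_atoms[OF xs])
      next
        case False
        have "qs ! s *v xs ! i = (if s = blk i then xs ! i else 0)"
          "qs ! t *v xs ! j = (if t = blk j then xs ! j else 0)"
          using st blk[OF ij(1)] blk[OF ij(2)] nest_atom_vec[OF nest, of s "blk i" "xs ! i"]
            nest_atom_vec[OF nest, of t "blk j" "xs ! j"] by simp_all
        thus ?thesis
          using False by auto
      qed
      finally show "cin (xs ! i) (qs ! s ** a ** qs ! t *v xs ! j) = cin (xs ! i) (0 *v xs ! j)"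
        by simp
    qed
    thus "a \<in> nest_alg qs"
      by (simp add: nest_alg_iff[OF nest])
  qed
  moreover have "S = ?T" if S: "triangular S" "?T \<subseteq> S" for S
  proof
    show "S \<subseteq> ?T"
    proof
      fix a assume a: "a \<in> S"
      have "cin (xs ! i) (a *v xs ! j) = 0" if ij: "i < length xs" "j < i" for i j
      proof (rule ccontr)
        assume c: "cin (xs ! i) (a *v xs ! j) \<noteq> 0" (is "?c \<noteq> 0")
        let ?o = "\<lambda>i j. outer (xs ! i) (xs ! j)"
        have upper: "?o k l \<in> S" if "k \<le> l" "l < length xs" for k l
          using outer_in_nest_alg_vector_atoms[OF xs that] S by blast
        have "?o i i ** a ** ?o j j = cscale ?c (?o i j)"
          using vector_atoms_block[of i xs j a] ij by simp
        hence "?o i j = cscale (1 / ?c) (?o i i ** a ** ?o j j)"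
          using c by (simp add: cscale_cscale)
        moreover have "?o i i ** a ** ?o j j \<in> S"
          using S a upper[of i i] upper[of j j] ij by (simp add: triangular_def subalgebra_def)
        ultimately have "?o i j \<in> S"
          using S by (auto simp: triangular_def subalgebra_def)
        moreover have "?o j i \<in> S"
          using upper ij by simp
        ultimately have "?o i j ** ?o j i = ?o j i ** ?o i j"
          using S by (auto simp: triangular_def adj_eq_ct)
        hence "?o i i *v xs ! i = ?o j j *v xs ! i"
          using ij by (simp add: mult_outer onb_cin[OF xs])
        thus False
          using ij unit_nonzero[of "xs ! i"] by (simp add: onb_cin[OF xs])
      qed
      thus "a \<in> ?T"
        by (simp add: nest_alg_vector_atoms[OF xs])
    qed
  qed (use S in auto)
  ultimately show ?thesis
    using vector_atoms_triangular[OF xs] by (simp add: maximal_triangular_in_def)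
qed

section \<open>Orthonormal sets whose vectors lie in atoms\<close>

definition orthonormal :: "(complex^'n) set \<Rightarrow> bool" where
  "orthonormal B \<longleftrightarrow> (\<forall>x\<in>B. \<forall>y\<in>B. cin x y = (if x = y then 1 else 0))"

lemma orthonormal_projection:
  assumes "finite B" "orthonormal B"
  shows "projection (\<Sum>b\<in>B. outer b b)"
proof -
  have "(\<Sum>b\<in>B. outer b b) ** (\<Sum>b\<in>B. outer b b) = (\<Sum>b\<in>B. \<Sum>c\<in>B. outer b b ** outer c c)"
    by (simp only: matrix_mult_sum_left) (simp only: matrix_mult_sum_right)
  also have "\<dots> = (\<Sum>b\<in>B. \<Sum>c\<in>B. if b = c then outer b b else 0)"
    using assms(2) by (auto simp: orthonormal_def mult_outer intro!: sum.cong)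
  also have "\<dots> = (\<Sum>b\<in>B. outer b b)"
    using assms(1) by simp
  finally show ?thesis
    by (simp add: projection_iff ct_sum)
qed

lemma projection_complement: "projection p \<Longrightarrow> projection (mat 1 - p)"
  by (simp add: projection_iff ct_diff matrix_mult_diff_left matrix_mult_diff_right)

lemma projection_form: "projection p \<Longrightarrow> cin x (p *v x) = cin (p *v x) (p *v x)"
  by (simp add: projection_iff cin_adjoint matrix_vector_mul_assoc)

text \<open>Bessel's inequality summed over the standard basis.\<close>

lemma orthonormal_card:
  fixes B :: "(complex^'n) set"
  assumes "finite B" "orthonormal B"
  shows "card B \<le> CARD('n)"
proof -
  have *: "(\<Sum>b\<in>B. (cmod (b $ k))\<^sup>2) \<le> 1" for k
  proof -
    let ?D = "mat 1 - (\<Sum>b\<in>B. outer b b)" and ?e = "axis k 1 :: complex^'n"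
    have "cin ?e (?D *v ?e) \<in> \<real>\<^sub>\<ge>\<^sub>0"
      using projection_form[OF projection_complement[OF orthonormal_projection[OF assms]], of ?e]
      by (simp add: cin_self_nonneg)
    also have "cin ?e (?D *v ?e) = 1 - (\<Sum>b\<in>B. cin b ?e * cin ?e b)"
      by (simp add: matrix_vector_mult_diff_rdistrib cin_diff_right sum_mult_vec cin_axis)
    also have "\<dots> = of_real (1 - (\<Sum>b\<in>B. (cmod (b $ k))\<^sup>2))"
    proof -
      have "cin b ?e * cin ?e b = of_real ((cmod (b $ k))\<^sup>2)" for b
        by (subst cin_commute) (simp add: cin_axis mult.commute complex_norm_square[symmetric])
      thus ?thesis by simp
    qed
    finally have "1 - (\<Sum>b\<in>B. (cmod (b $ k))\<^sup>2) \<ge> 0"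
      by (simp only: nonneg_Reals_of_real_iff)
    thus ?thesis by simp
  qed
  have norm: "(\<Sum>k\<in>UNIV. (cmod (b $ k))\<^sup>2) = 1" if "b \<in> B" for b
  proof -
    have "complex_of_real (\<Sum>k\<in>UNIV. (cmod (b $ k))\<^sup>2) = of_real 1"
      using assms(2) that by (simp only: cin_self[symmetric] orthonormal_def) simp
    thus ?thesis by (simp only: of_real_eq_iff)
  qed
  have "real (card B) = (\<Sum>b\<in>B. \<Sum>k\<in>UNIV. (cmod (b $ k))\<^sup>2)"
    by (simp add: norm)
  also have "\<dots> = (\<Sum>k\<in>UNIV. \<Sum>b\<in>B. (cmod (b $ k))\<^sup>2)"
    by (rule sum.swap)
  also have "\<dots> \<le> (\<Sum>k\<in>(UNIV :: 'n set). 1)"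
    by (intro sum_mono *)
  finally show ?thesis by simp
qed

text \<open>Take B of greatest cardinality, which \<open>orthonormal_card\<close> bounds. Each
  vector of B lies in an atom, so the projection D onto the orthogonal complement of B commutes with
  all atoms. If D were nonzero, a nonzero component q_s x of a vector x fixed by D would again be
  fixed by D, and after normalization it would enlarge B.\<close>

lemma adapted_orthonormal_extension:
  fixes F :: "(complex^'n) set"
  assumes nest: "nest_atoms qs" and F: "finite F" "orthonormal F"
    and blk: "\<And>x. x \<in> F \<Longrightarrow> \<exists>s<length qs. qs ! s *v x = x"
  obtains B where "F \<subseteq> B" "finite B" "orthonormal B" "(\<Sum>b\<in>B. outer b b) = mat 1"
    "\<And>x. x \<in> B \<Longrightarrow> \<exists>s<length qs. qs ! s *v x = x"
proof -
  let ?P = "\<lambda>B. F \<subseteq> B \<and> finite B \<and> orthonormal B \<and> (\<forall>x\<in>B. \<exists>s<length qs. qs ! s *v x = x)"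
  have "?P F" and "\<forall>B. ?P B \<longrightarrow> card B < Suc (CARD('n))"
    using F blk orthonormal_card[where 'n = 'n] by (auto simp: le_imp_less_Suc)
  then obtain B where B: "?P B" and max: "\<And>B'. ?P B' \<Longrightarrow> card B' \<le> card B"
    using Lattices_Big.ex_has_greatest_nat[of ?P F card "Suc (CARD('n))"] by blast
  define D where "D = mat 1 - (\<Sum>b\<in>B. outer b b)"
  have D: "projection D"
    unfolding D_def using B by (intro projection_complement orthonormal_projection) auto
  have Db: "D *v b = 0" if "b \<in> B" for b
  proof -
    have "(\<Sum>c\<in>B. cin c b *s c) = (\<Sum>c\<in>B. if c = b then b else 0)"
      using B that by (intro sum.cong) (auto simp: orthonormal_def)
    thus ?thesis
      using B that by (simp add: D_def matrix_vector_mult_diff_rdistrib sum_mult_vec)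
  qed
  have comm: "qs ! s *v (D *v x) = D *v (qs ! s *v x)" if s: "s < length qs" for s x
  proof -
    have "qs ! s *v (cin b x *s b) = cin b (qs ! s *v x) *s b" if b: "b \<in> B" for b
    proof -
      obtain t where t: "t < length qs" "qs ! t *v b = b"
        using B b by blast
      show ?thesis
        unfolding matrix_mult_scale cin_adjoint[of b] nest_atom_projection(1)[OF nest s]
          nest_atom_vec[OF nest s t]
        by simp
    qed
    thus ?thesis
      by (simp add: D_def matrix_vector_mult_diff_rdistrib matrix_vector_mult_diff_distrib
          sum_mult_vec mult_vec_sum)
  qed
  have "D = 0"
  proof (rule ccontr)
    assume "D \<noteq> 0"
    then obtain x where x: "D *v x = x" "cin x x = 1"
      using projection_unit_vector[OF D] by metis
    have "\<exists>s<length qs. qs ! s *v x \<noteq> 0"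
    proof (rule ccontr)
      assume "\<not> ?thesis"
      hence "x = 0"
        using nest_atoms_sum_vec[OF nest, of x] by simp
      thus False using x by simp
    qed
    then obtain s where s: "s < length qs" "qs ! s *v x \<noteq> 0" by blast
    obtain c where c: "cin (c *s (qs ! s *v x)) (c *s (qs ! s *v x)) = 1"
      by (rule exists_normalize[OF s(2)])
    define y where "y = c *s (qs ! s *v x)"
    have y: "cin y y = 1" "qs ! s *v y = y" "D *v y = y"
      using c s x comm[of s x]
      by (simp_all add: y_def nest_atom_mult_vec[OF nest])
    have orth: "cin y b = 0" "cin b y = 0" if "b \<in> B" for b
    proof -
      have "cin y b = cin (D *v y) b" using y by simp
      also have "\<dots> = 0"
        using D Db[OF that] by (simp add: cin_adjoint' projection_iff)
      finally show "cin y b = 0" .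
      thus "cin b y = 0" by (simp add: cin_eq0_commute)
    qed
    hence "y \<notin> B" using y by force
    moreover have "?P (insert y B)"
      using B y orth s by (auto simp: orthonormal_def)
    ultimately show False
      using max[of "insert y B"] B by auto
  qed
  thus ?thesis
    using B that[of B] unfolding D_def by (metis eq_iff_diff_eq_0)
qed

text \<open>The callers encode the order they want in \<open>key\<close>; the order among vectors of
  equal key is left open.\<close>

lemma orthonormal_sorted_list:
  fixes key :: "complex^'n \<Rightarrow> nat"
  assumes "finite B" "orthonormal B" "(\<Sum>b\<in>B. outer b b) = mat 1"
  obtains xs where "onb xs" "set xs = B"
    "\<And>i j. i \<le> j \<Longrightarrow> j < length xs \<Longrightarrow> key (xs ! i) \<le> key (xs ! j)"
proof -
  obtain ys where ys: "set ys = B" "distinct ys"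
    using finite_distinct_list[OF assms(1)] by metis
  define xs where "xs = sort_key key ys"
  have xs: "set xs = B" "distinct xs" "sorted (map key xs)"
    using ys by (simp_all add: xs_def)
  have "(\<Sum>i<length xs. outer (xs ! i) (xs ! i)) = sum_list (map (\<lambda>x. outer x x) xs)"
    by (simp add: sum_list_sum_nth atLeast0LessThan)
  also have "\<dots> = mat 1"
    using xs assms(3) by (simp add: sum_list_distinct_conv_sum_set)
  finally have "onb xs"
    using xs assms(2) by (auto simp: onb_def orthonormal_def nth_eq_iff_index_eq)
  moreover have "key (xs ! i) \<le> key (xs ! j)" if "i \<le> j" "j < length xs" for i j
    using sorted_nth_mono[OF xs(3), of i j] that by simp
  ultimately show ?thesis
    using xs(1) that by blast
qed

section \<open>Sums of isometric conjugations\<close>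

text \<open>\<open>a\<close> and its adjoint are both block upper triangular, so \<open>a\<close> is
  block diagonal.\<close>

lemma nest_alg_selfadjoint_commute:
  assumes "nest_atoms qs" "a \<in> nest_alg qs" "ct a \<in> nest_alg qs" "i < length qs"
  shows "qs ! i ** a = a ** qs ! i"
proof -
  have off: "qs ! i ** a ** qs ! j = 0" if "i < length qs" "j < length qs" "i \<noteq> j" for i j
  proof (cases "j < i")
    case True
    thus ?thesis using assms that by (simp add: nest_alg_iff)
  next
    case False
    hence "qs ! j ** ct a ** qs ! i = 0"
      using assms that by (simp add: nest_alg_iff)
    hence "ct (qs ! j ** ct a ** qs ! i) = 0"
      by simp
    thus ?thesis
      using that by (simp add: ct_mult nest_atom_projection(1)[OF assms(1)] matrix_mul_assoc)
  qed
  have "qs ! i ** a = (\<Sum>j<length qs. qs ! i ** a ** qs ! j)"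
    using nest_atoms_sum[OF assms(1)] by (simp flip: matrix_mult_sum_right)
  also have "\<dots> = (\<Sum>j<length qs. if j = i then qs ! i ** a ** qs ! i else 0)"
    using off assms(4) by (intro sum.cong) auto
  also have "\<dots> = (\<Sum>j<length qs. qs ! j ** (a ** qs ! i))"
    using off assms(4) by (intro sum.cong) (auto simp: matrix_mul_assoc)
  also have "\<dots> = a ** qs ! i"
    using nest_atoms_sum[OF assms(1)] by (simp flip: matrix_mult_sum_left)
  finally show ?thesis .
qed

lemma nest_atom_unit_vector:
  assumes "nest_atoms qs" "i < length qs"
  obtains x where "qs ! i *v x = x" "cin x x = 1"
  using projection_unit_vector[of "qs ! i"] nest_atom_projection[OF assms] by metis

text \<open>The case i = j is the one that needs the rank condition; it occurs because test pieces
  share a row or a column atom.\<close>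

lemma nest_atoms_two_unit_vectors:
  assumes nest: "nest_atoms qs" and rk: "\<forall>q\<in>set qs. rank q \<noteq> 1" and "i < length qs" "j < length qs"
  obtains x y where "qs ! i *v x = x" "qs ! j *v y = y" "cin x x = 1" "cin y y = 1" "cin x y = 0"
proof (cases "i = j")
  case True
  have "rank (qs ! i) \<noteq> 1"
    using rk assms(3) by auto
  thus ?thesis
    using projection_two_unit_vectors[of "qs ! i"] nest_atom_projection[OF assms(1,3)] True that
    by metis
next
  case False
  obtain x y where "qs ! i *v x = x" "cin x x = 1" "qs ! j *v y = y" "cin y y = 1"
    using nest_atom_unit_vector assms by metis
  thus ?thesis
    using nest_atoms_cin[OF nest assms(3,4) False] that by blast
qed

lemma op_le_iff: "op_le a b \<longleftrightarrow> (\<forall>x. cin x ((b - a) *v x) \<in> \<real>\<^sub>\<ge>\<^sub>0)"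
  by (simp only: op_le_def cin_def)

lemma partial_isometry_iff: "partial_isometry v \<longleftrightarrow> v ** ct v ** v = v"
  by (simp add: partial_isometry_def adj_eq_ct)

lemma partial_isometry_zero: "partial_isometry 0"
  by (simp add: partial_isometry_iff)

lemma partial_isometry_outer: "cin x x = 1 \<Longrightarrow> cin y y = 1 \<Longrightarrow> partial_isometry (outer x y)"
  by (simp add: partial_isometry_iff mult_outer)

lemma partial_isometry_outer_sum:
  assumes "cin x x = 1" "cin y y = 1" "cin x' x' = 1" "cin y' y' = 1" "cin x x' = 0" "cin y y' = 0"
  shows "partial_isometry (outer x y + outer x' y')"
proof -
  have "cin x' x = 0" "cin y' y = 0"
    using assms by (simp_all add: cin_eq0_commute)
  thus ?thesis
    using assms by (simp add: partial_isometry_iff ct_add matrix_add_ldistrib matrix_mult_add_left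
        matrix_vector_mult_add_rdistrib mult_outer)
qed

text \<open>The data read off from a regular embedding: one isometry for each summand, with pairwise
  orthogonal ranges. The assumption \<open>into\<close> concerns each summand separately, since each
  will have its own map of atoms. No summands at all, r = 0, is allowed.\<close>

locale isometry_sum =
  fixes qs1 :: "(complex^'n^'n) list" and qs2 :: "(complex^'m^'m) list"
    and r :: nat and U :: "nat \<Rightarrow> complex^'n^'m"
  assumes nest1: "nest_atoms qs1" and nest2: "nest_atoms qs2"
    and iso: "i < r \<Longrightarrow> j < r \<Longrightarrow> ct (U i) ** U j = (if i = j then mat 1 else 0)"
    and into: "i < r \<Longrightarrow> a \<in> nest_alg qs1 \<Longrightarrow> U i ** a ** ct (U i) \<in> nest_alg qs2"
begin

text \<open>The embedding itself is \<open>conj_sum {..<r}\<close>; other index sets give the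
  partial sums from which ordered decompositions are built.\<close>

definition conj_sum :: "nat set \<Rightarrow> complex^'n^'n \<Rightarrow> complex^'m^'m" where
  "conj_sum S a = (\<Sum>i\<in>S. U i ** a ** ct (U i))"

lemma iso_vec:
  assumes "i < r" "j < r"
  shows "ct (U i) *v (U j *v x) = (if i = j then x else 0)"
  using iso[OF assms] by (auto simp: matrix_vector_mul_assoc)

lemma iso_cin:
  assumes "i < r" "j < r"
  shows "cin (U i *v x) (U j *v y) = (if i = j then cin x y else 0)"
  using iso_vec[OF assms, of y] by (simp add: cin_adjoint')

lemma conj_sum_vec:
  assumes "S \<subseteq> {..<r}" "i < r"
  shows "conj_sum S a *v (U i *v x) = (if i \<in> S then U i *v (a *v x) else 0)"
proof -
  have "conj_sum S a *v (U i *v x) = (\<Sum>j\<in>S. if j = i then U i *v (a *v x) else 0)"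
    unfolding conj_sum_def sum_mult_vec mult_vec_assoc
    using assms by (intro sum.cong refl) (auto simp: iso_vec subset_iff)
  thus ?thesis
    using finite_subset[OF assms(1)] by simp
qed

lemma conj_sum_in: "S \<subseteq> {..<r} \<Longrightarrow> a \<in> nest_alg qs1 \<Longrightarrow> conj_sum S a \<in> nest_alg qs2"
  unfolding conj_sum_def by (intro nest_alg_sum nest2 into) auto

text \<open>The cross terms vanish. Taking S = S' yields multiplicativity, taking disjoint sets
  yields orthogonality of the two parts of a decomposition.\<close>

lemma conj_sum_mult:
  assumes "S \<subseteq> {..<r}" "S' \<subseteq> {..<r}"
  shows "conj_sum S a ** conj_sum S' b = conj_sum (S \<inter> S') (a ** b)"
proof -
  have fin: "finite S" "finite S'"
    using assms finite_subset by blast+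
  have "conj_sum S a ** conj_sum S' b =
      (\<Sum>j\<in>S'. conj_sum S a ** (U j ** b ** ct (U j)))"
    by (simp only: conj_sum_def[of S'] matrix_mult_sum_right)
  also have "\<dots> = (\<Sum>j\<in>S'. if j \<in> S then U j ** (a ** b) ** ct (U j) else 0)"
  proof (intro sum.cong refl)
    fix j assume "j \<in> S'"
    hence "j < r" using assms by auto
    thus "conj_sum S a ** (U j ** b ** ct (U j)) = (if j \<in> S then U j ** (a ** b) ** ct (U j) else 0)"
      by (intro matrix_vec_eqI) (simp add: mult_vec_assoc conj_sum_vec[OF assms(1)])
  qed
  also have "\<dots> = conj_sum (S' \<inter> S) (a ** b)"
    using fin by (simp add: conj_sum_def sum.inter_restrict)
  finally show ?thesis by (simp add: Int_commute)
qed

lemma conj_sum_star_hom: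
  assumes "S \<subseteq> {..<r}"
  shows "star_hom (conj_sum S)"
proof -
  have "conj_sum S (a + b) = conj_sum S a + conj_sum S b" for a b
    by (simp add: conj_sum_def matrix_add_ldistrib matrix_mult_add_left sum.distrib)
  moreover have "conj_sum S (cscale c a) = cscale c (conj_sum S a)" for c a
    by (rule matrix_vec_eqI)
      (simp add: conj_sum_def sum_mult_vec mult_vec_assoc cscale_mult_vec vec.scale_sum_right)
  moreover have "conj_sum S (ct a) = ct (conj_sum S a)" for a
    by (simp add: conj_sum_def ct_sum ct_mult matrix_mul_assoc)
  ultimately show ?thesis
    using conj_sum_mult[OF assms assms] by (simp add: star_hom_def adj_eq_ct)
qed

lemma conj_sum_one_nonzero:
  assumes "S \<subseteq> {..<r}" "S \<noteq> {}"
  shows "conj_sum S (mat 1) \<noteq> 0"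
proof
  assume z: "conj_sum S (mat 1) = 0"
  obtain i where i: "i \<in> S" "i < r"
    using assms by auto
  obtain x where x: "qs1 ! 0 *v x = x" "cin x x = 1"
    by (rule nest_atom_unit_vector[OF nest1 nest_atoms_nonempty[OF nest1]])
  have "U i *v x = 0"
    using conj_sum_vec[OF assms(1) i(2), of "mat 1" x] i z by simp
  thus False
    using iso_cin[OF i(2) i(2), of x x] x by simp
qed

text \<open>Within an atom $q$ of $A_1$ the matrix units and their adjoints lie in $A_1$, so their images
  commute with the atoms of $A_2$; hence each summand carries $q$ into a single atom.\<close>

lemma atom_into_atom:
  assumes i: "i < r" and k: "k < length qs1"
  shows "\<exists>s<length qs2. \<forall>x. qs1 ! k *v x = x \<longrightarrow> qs2 ! s *v (U i *v x) = U i *v x"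
proof -
  obtain y where y: "qs1 ! k *v y = y" "cin y y = 1"
    using nest_atom_unit_vector[OF nest1 k] by metis
  \<comment> \<open>The candidate eigenvalue of \<open>qs2 ! s\<close> on the whole image of the
    atom: read off at the fixed y, it does not depend on x. Nonzero values are 1 by idempotence, and
    the values add up to 1, so a nonzero one exists.\<close>
  define l where "l s = cin (U i *v y) (qs2 ! s *v (U i *v y))" for s
  have Uy: "cin (U i *v y) (U i *v y) = 1"
    using iso_cin[OF i i, of y y] y by simp
  have l: "qs2 ! s *v (U i *v x) = l s *s (U i *v x)" if s: "s < length qs2" and x: "qs1 ! k *v x = x" for s x
  proof -
    have "outer (U i *v x) (U i *v y) \<in> nest_alg qs2" "outer (U i *v y) (U i *v x) \<in> nest_alg qs2"
      using into[OF i outer_in_nest_alg[OF nest1 order.refl k x y(1)]]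
        into[OF i outer_in_nest_alg[OF nest1 order.refl k y(1) x]]
      by (simp_all add: mult_outer outer_mult)
    hence "qs2 ! s ** outer (U i *v x) (U i *v y) = outer (U i *v x) (U i *v y) ** qs2 ! s"
      by (intro nest_alg_selfadjoint_commute[OF nest2 _ _ s]) simp_all
    hence "qs2 ! s ** outer (U i *v x) (U i *v y) *v (U i *v y)
        = outer (U i *v x) (U i *v y) ** qs2 ! s *v (U i *v y)"
      by simp
    thus ?thesis
      using Uy by (simp add: mult_vec_assoc l_def)
  qed
  have "(\<Sum>s<length qs2. l s) = cin (U i *v y) (\<Sum>s<length qs2. qs2 ! s *v (U i *v y))"
    by (simp add: l_def cin_sum_right)
  also have "\<dots> = 1"
    using Uy by (simp add: nest_atoms_sum_vec[OF nest2])
  finally have "(\<Sum>s<length qs2. l s) \<noteq> 0" by simp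
  then obtain s where s: "s < length qs2" "l s \<noteq> 0"
    by (meson sum.neutral lessThan_iff)
  have "qs2 ! s *v (qs2 ! s *v (U i *v y)) = qs2 ! s *v (U i *v y)"
    using s by (simp add: nest_atom_mult_vec[OF nest2])
  hence "(l s * l s) *s (U i *v y) = l s *s (U i *v y)"
    using l[OF s(1) y(1)] by (simp add: vector_smult_assoc)
  hence "l s = 1"
    using s unit_nonzero[OF Uy] by simp
  thus ?thesis
    using s l by auto
qed

text \<open>The sigma_i of the overview. All later uses go through the two properties in the lemma
  \<open>atom_map\<close>.\<close>

definition atom_map :: "nat \<Rightarrow> nat \<Rightarrow> nat" where
  "atom_map i k =
    (SOME s. s < length qs2 \<and> (\<forall>x. qs1 ! k *v x = x \<longrightarrow> qs2 ! s *v (U i *v x) = U i *v x))"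

lemma atom_map:
  assumes "i < r" "k < length qs1"
  shows "atom_map i k < length qs2"
    and "qs1 ! k *v x = x \<Longrightarrow> qs2 ! atom_map i k *v (U i *v x) = U i *v x"
  using someI_ex[OF atom_into_atom[OF assms]] unfolding atom_map_def by blast+

text \<open>A rank one element of the block (k,k') of A1 is carried by the summand to a nonzero
  element of the block given by the two values; were these in the wrong order, the image would lie
  below the diagonal of A2.\<close>

lemma atom_map_mono:
  assumes "i < r" "k \<le> k'" "k' < length qs1"
  shows "atom_map i k \<le> atom_map i k'"
proof (rule ccontr)
  assume less: "\<not> ?thesis"
  have k: "k < length qs1" using assms by simp
  obtain x where x: "qs1 ! k *v x = x" "cin x x = 1"
    using nest_atom_unit_vector[OF nest1 k] by metis
  obtain y where y: "qs1 ! k' *v y = y" "cin y y = 1"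
    using nest_atom_unit_vector[OF nest1 assms(3)] by metis
  have "outer (U i *v x) (U i *v y) \<in> nest_alg qs2"
    using into[OF assms(1) outer_in_nest_alg[OF nest1 assms(2,3) x(1) y(1)]]
    by (simp add: mult_outer outer_mult)
  hence "qs2 ! atom_map i k ** outer (U i *v x) (U i *v y) ** qs2 ! atom_map i k' = 0"
    using less atom_map(1)[OF assms(1) k] by (simp add: nest_alg_iff[OF nest2])
  hence "outer (U i *v x) (U i *v y) = 0"
    using atom_map(2)[OF assms(1) k x(1)] atom_map(2)[OF assms(1,3) y(1)]
      nest_atom_projection(1)[OF nest2 atom_map(1)[OF assms(1,3)]]
    by (simp add: mult_outer outer_mult)
  moreover have "U i *v x \<noteq> 0" "U i *v y \<noteq> 0"
    using iso_cin[OF assms(1) assms(1)] x(2) y(2) unit_nonzero by metis+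
  ultimately show False
    using outer_nonzero by blast
qed

lemma mult_isometry_eqI:
  assumes "i < r" "\<And>k x. k < length qs1 \<Longrightarrow> qs1 ! k *v x = x \<Longrightarrow> A *v (U i *v x) = B *v (U i *v x)"
  shows "A ** U i = B ** U i"
proof (rule matrix_vec_eqI)
  fix x
  have "A *v (U i *v (\<Sum>k<length qs1. qs1 ! k *v x)) = B *v (U i *v (\<Sum>k<length qs1. qs1 ! k *v x))"
    unfolding mult_vec_sum
    by (intro sum.cong refl assms(2)) (auto simp: nest_atom_mult_vec[OF nest1])
  thus "(A ** U i) *v x = (B ** U i) *v x"
    by (simp add: nest_atoms_sum_vec[OF nest1] mult_vec_assoc)
qed

lemma atom_mult_isometry_eq0:
  assumes "i < r" "s < length qs2" "\<And>k. k < length qs1 \<Longrightarrow> atom_map i k \<noteq> s"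
  shows "qs2 ! s ** U i = 0"
proof -
  have "qs2 ! s ** U i = 0 ** U i"
  proof (rule mult_isometry_eqI[OF assms(1)])
    fix k x assume k: "k < length qs1" and x: "qs1 ! k *v x = x"
    show "qs2 ! s *v (U i *v x) = 0 *v (U i *v x)"
      using nest_atom_vec[OF nest2 assms(2) atom_map(1)[OF assms(1) k] atom_map(2)[OF assms(1) k x]]
        assms(3)[OF k] by simp
  qed
  thus ?thesis by simp
qed

text \<open>A partial isometry with two rank one pieces, in the blocks $(a,b)$ and $(c,d)$ of $A_1$,
  tests order conservation of the blocks of the summands $i$ and $j$.\<close>

lemma order_conserving_atom_map:
  assumes \<phi>: "\<And>a. a \<in> nest_alg qs1 \<Longrightarrow> \<phi> a = conj_sum {..<r} a"
    and oc: "order_conserving qs1 qs2 \<phi>" and rk: "\<forall>q\<in>set qs1. rank q \<noteq> 1"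
    and i: "i < r" and j: "j < r"
    and ab: "a \<le> b" "b < length qs1" and cd: "c \<le> d" "d < length qs1"
    and nested: "\<not> (a < c \<and> d < b)" "\<not> (c < a \<and> b < d)"
  shows "\<not> (atom_map i a < atom_map j c \<and> atom_map j d < atom_map i b)"
proof -
  have a: "a < length qs1" and c: "c < length qs1" using ab cd by auto
  obtain x x' where x: "qs1 ! a *v x = x" "qs1 ! c *v x' = x'" "cin x x = 1" "cin x' x' = 1" "cin x x' = 0"
    using nest_atoms_two_unit_vectors[OF nest1 rk a c] by metis
  obtain y y' where y: "qs1 ! b *v y = y" "qs1 ! d *v y' = y'" "cin y y = 1" "cin y' y' = 1" "cin y y' = 0"
    using nest_atoms_two_unit_vectors[OF nest1 rk ab(2) cd(2)] by metis
  define v where "v = outer x y + outer x' y'"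
  have v: "v \<in> nest_alg qs1"
    unfolding v_def
    by (intro nest_alg_add nest1 outer_in_nest_alg[OF nest1 ab x(1) y(1)] outer_in_nest_alg[OF nest1 cd x(2) y(2)])
  \<comment> \<open>Two independent terms rather than a case distinction, because the blocks (a,b)
    and (c,d) may coincide.\<close>
  have block: "qs1 ! k ** v ** qs1 ! l =
      (if k = a \<and> l = b then outer x y else 0) + (if k = c \<and> l = d then outer x' y' else 0)"
    if "k < length qs1" "l < length qs1" for k l
  proof -
    have "qs1 ! k ** v ** qs1 ! l =
        outer (qs1 ! k *v x) (qs1 ! l *v y) + outer (qs1 ! k *v x') (qs1 ! l *v y')"
      using nest_atom_projection(1)[OF nest1 that(2)]
      by (simp add: v_def matrix_add_ldistrib matrix_mult_add_left mult_outer outer_mult)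
    thus ?thesis
      unfolding nest_atom_vec[OF nest1 that(1) a x(1)] nest_atom_vec[OF nest1 that(1) c x(2)]
        nest_atom_vec[OF nest1 that(2) ab(2) y(1)] nest_atom_vec[OF nest1 that(2) cd(2) y(2)]
      by auto
  qed
  have "partial_isometry v"
    unfolding v_def using x y by (intro partial_isometry_outer_sum)
  moreover have "partial_isometry (qs1 ! k ** v ** qs1 ! l)" if "k < length qs1" "l < length qs1" for k l
    unfolding block[OF that] using x y partial_isometry_outer_sum[of x y x' y']
    by (auto simp: partial_isometry_zero partial_isometry_outer)
  ultimately have "v \<in> pisom_reg qs1"
    using v by (simp add: pisom_reg_def)
  moreover have "qs1 ! s ** v ** qs1 ! t = 0"
    if nz: "qs1 ! k ** v ** qs1 ! l \<noteq> 0" and *: "k < length qs1" "l < length qs1" "s < k" "l < t" "t < length qs1"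
    for k l s t
  proof -
    \<comment> \<open>Every nonzero block is one of the two pieces, no block is strictly nested in
      itself, and \<open>nested\<close> excludes the mixed cases.\<close>
    have "(k, l) = (a, b) \<or> (k, l) = (c, d)"
      using nz unfolding block[OF *(1,2)] by (auto split: if_splits)
    hence "(s, t) \<noteq> (a, b)" "(s, t) \<noteq> (c, d)"
      using * nested by auto
    thus ?thesis
      using block[of s t] * by auto
  qed
  ultimately have "v \<in> pisom_oc qs1"
    by (auto simp: pisom_oc_def)
  hence oc': "\<phi> v \<in> pisom_oc qs2"
    using oc by (auto simp: order_conserving_def)
  \<comment> \<open>The block is tested on the vector U_h z: \<phi> v sends it to U_h w, and the
    atoms on both sides fix these vectors.\<close>
  have nz: "qs2 ! atom_map h k ** \<phi> v ** qs2 ! atom_map h l \<noteq> 0"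
    if h: "h < r" and k: "k < length qs1" and l: "l < length qs1"
      and z: "qs1 ! l *v z = z" and w: "qs1 ! k *v w = w" "cin w w = 1" and vz: "v *v z = w" for h k l z w
  proof
    assume "qs2 ! atom_map h k ** \<phi> v ** qs2 ! atom_map h l = 0"
    hence "qs2 ! atom_map h k ** \<phi> v ** qs2 ! atom_map h l *v (U h *v z) = 0"
      by simp
    hence "U h *v w = 0"
      using atom_map(2)[OF h k w(1)] atom_map(2)[OF h l z] conj_sum_vec[OF order.refl h, of v z] h vz
      by (simp add: mult_vec_assoc \<phi>[OF v])
    thus False
      using iso_cin[OF h h, of w w] w by simp
  qed
  have "v *v y = x" "v *v y' = x'"
    using y cin_eq0_commute[of y y'] by (simp_all add: v_def matrix_vector_mult_add_rdistrib)
  hence "qs2 ! atom_map i a ** \<phi> v ** qs2 ! atom_map i b \<noteq> 0"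
    and "qs2 ! atom_map j c ** \<phi> v ** qs2 ! atom_map j d \<noteq> 0"
    using nz[OF i a ab(2) y(1) x(1,3)] nz[OF j c cd(2) y(2) x(2,4)] by auto
  moreover have "\<forall>k<length qs2. \<forall>l<length qs2. qs2 ! k ** \<phi> v ** qs2 ! l \<noteq> 0 \<longrightarrow>
      (\<forall>s t. s < k \<and> l < t \<and> t < length qs2 \<longrightarrow> qs2 ! s ** \<phi> v ** qs2 ! t = 0)"
    using oc' unfolding pisom_oc_def by blast
  ultimately show ?thesis
    using atom_map(1)[OF i ab(2)] atom_map(1)[OF j c] atom_map(1)[OF j cd(2)] by blast
qed

text \<open>If S were proper, \<phi> would be the ordered sum of its parts over S and over the
  complement: no atom met by the first part comes after an atom met by the second. The weak
  inequality in \<open>le\<close> suffices because ordered sums may share an atom.\<close>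

lemma order_irreducible_atom_map:
  assumes \<phi>: "\<And>a. a \<in> nest_alg qs1 \<Longrightarrow> \<phi> a = conj_sum {..<r} a"
    and irr: "order_irreducible qs1 qs2 \<phi>"
    and S: "S \<subseteq> {..<r}" "S \<noteq> {}"
    and le: "\<And>i j. i \<in> S \<Longrightarrow> j < r \<Longrightarrow> j \<notin> S \<Longrightarrow> atom_map i (length qs1 - 1) \<le> atom_map j 0"
  shows "S = {..<r}"
proof (rule ccontr)
  assume "S \<noteq> {..<r}"
  define S' where "S' = {..<r} - S"
  have S': "S' \<subseteq> {..<r}" "S' \<noteq> {}" "S \<inter> S' = {}" "S \<union> S' = {..<r}"
    using S \<open>S \<noteq> {..<r}\<close> by (auto simp: S'_def)
  have len: "0 < length qs1"
    by (rule nest_atoms_nonempty[OF nest1])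
  have ext: "star_extendible (nest_alg qs1) (nest_alg qs2) (conj_sum T)" if "T \<subseteq> {..<r}" for T
    using conj_sum_in[OF that] conj_sum_star_hom[OF that]
    by (auto simp: star_extendible_def star_extension_def)
  have "conj_sum S (mat 1) ** conj_sum S' (mat 1) = 0" "conj_sum S' (mat 1) ** conj_sum S (mat 1) = 0"
    using S' by (simp_all add: conj_sum_mult S Int_commute[of S'] conj_sum_def[of "{}"])
  moreover have "\<phi> a = conj_sum S a + conj_sum S' a" if "a \<in> nest_alg qs1" for a
  proof -
    have "finite S" "finite S'"
      using S(1) S'(1) finite_subset by blast+
    thus ?thesis
      using S' sum.union_disjoint[of S S'] by (simp add: \<phi>[OF that] conj_sum_def)
  qed
  ultimately have "direct_sum (nest_alg qs1) \<phi> [conj_sum S, conj_sum S']"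
    by (auto simp: direct_sum_def less_Suc_eq numeral_2_eq_2)
  moreover have support: "\<exists>i\<in>T. \<exists>k<length qs1. atom_map i k = s"
    if "T \<subseteq> {..<r}" "s < length qs2" "qs2 ! s ** conj_sum T (mat 1) \<noteq> 0" for T s
  proof (rule ccontr)
    assume "\<not> ?thesis"
    hence "qs2 ! s ** U i = 0" if "i \<in> T" for i
      using atom_mult_isometry_eq0[of i s] \<open>T \<subseteq> {..<r}\<close> \<open>s < length qs2\<close> that by blast
    hence "qs2 ! s ** conj_sum T (mat 1) = 0"
      by (simp add: conj_sum_def matrix_mult_sum_right matrix_mul_assoc)
    thus False using that by simp
  qed
  have "qs2 ! t ** conj_sum S (mat 1) = 0"
    if st: "s < t" "t < length qs2" and nz: "qs2 ! s ** conj_sum S' (mat 1) \<noteq> 0" for s t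
  proof (rule ccontr)
    assume nz': "qs2 ! t ** conj_sum S (mat 1) \<noteq> 0"
    obtain j k where jk: "j \<in> S'" "k < length qs1" "atom_map j k = s"
      using support[OF S'(1) _ nz] st by force
    obtain i k' where ik: "i \<in> S" "k' < length qs1" "atom_map i k' = t"
      using support[OF S(1) st(2) nz'] by blast
    have "t \<le> atom_map i (length qs1 - 1)"
      using atom_map_mono[of i k' "length qs1 - 1"] ik S(1) len by auto
    also have "\<dots> \<le> atom_map j 0"
      using le[OF ik(1)] jk by (simp add: S'_def)
    also have "\<dots> \<le> s"
      using atom_map_mono[of j 0 k] jk S'(1) by auto
    finally show False using st by simp
  qed
  ultimately have "ordered_sum qs1 qs2 \<phi> [conj_sum S, conj_sum S']"
    using ext[OF S(1)] ext[OF S'(1)]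
    by (auto simp: ordered_sum_def less_Suc_eq numeral_2_eq_2)
  moreover have "\<exists>a\<in>nest_alg qs1. conj_sum S a \<noteq> 0" "\<exists>a\<in>nest_alg qs1. conj_sum S' a \<noteq> 0"
    using conj_sum_one_nonzero[OF S] conj_sum_one_nonzero[OF S'(1,2)] mat1_in_nest_alg[OF nest1]
    by blast+
  ultimately show False
    using irr by (auto simp: order_irreducible_def)
qed

lemma T2_degenerateI:
  assumes \<phi>: "\<And>a. a \<in> nest_alg qs1 \<Longrightarrow> \<phi> a = conj_sum {..<r} a"
    and ab: "a < length qs2" "b < length qs2"
    and two: "\<And>i k. i < r \<Longrightarrow> k < length qs1 \<Longrightarrow> atom_map i k = a \<or> atom_map i k = b"
  shows "T2_degenerate qs2 \<phi>"
proof -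
  let ?E = "conj_sum {..<r} (mat 1)"
  \<comment> \<open>The two atoms may coincide, and then their sum is twice a projection. The
    comparison is made with the projection N, where N - \<phi>(1) is again a projection; for a = b
    the second copy of the atom only adds a nonnegative form.\<close>
  define N where "N = (if a = b then qs2 ! a else qs2 ! a + qs2 ! b)"
  have N: "projection N"
    using ab by (simp add: N_def projection_iff nest_atom_projection[OF nest2] ct_add
        matrix_add_ldistrib matrix_mult_add_left nest_atom_mult[OF nest2])
  have "N ** U i = U i" if i: "i < r" for i
  proof -
    have "N ** U i = mat 1 ** U i"
    proof (rule mult_isometry_eqI[OF i])
      fix k x assume kx: "k < length qs1" "qs1 ! k *v x = x"
      have "qs2 ! s *v (U i *v x) = (if s = atom_map i k then U i *v x else 0)"
        if "s < length qs2" for s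
        by (rule nest_atom_vec[OF nest2 that atom_map(1)[OF i kx(1)] atom_map(2)[OF i kx]])
      thus "N *v (U i *v x) = mat 1 *v (U i *v x)"
        using two[OF i kx(1)] ab
        by (auto simp: N_def matrix_vector_mult_add_rdistrib)
    qed
    thus ?thesis by simp
  qed
  hence NE: "N ** ?E = ?E"
    by (simp add: conj_sum_def matrix_mult_sum_right matrix_mul_assoc)
  have E: "ct ?E = ?E" "?E ** ?E = ?E"
    by (simp_all add: conj_sum_mult) (simp add: conj_sum_def ct_sum ct_mult)
  have "?E ** N = ct (N ** ?E)"
    using N E by (simp add: ct_mult projection_iff)
  hence "?E ** N = ?E"
    using NE E by simp
  hence "projection (N - ?E)"
    using N NE E by (simp add: projection_iff ct_diff matrix_mult_diff_left matrix_mult_diff_right)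
  hence 1: "cin x ((N - ?E) *v x) \<in> \<real>\<^sub>\<ge>\<^sub>0" for x
    by (simp add: projection_form cin_self_nonneg)
  have 2: "cin x (qs2 ! a *v x) \<in> \<real>\<^sub>\<ge>\<^sub>0" for x
    using nest_atom_projection(4)[OF nest2 ab(1)] by (simp add: projection_form cin_self_nonneg)
  have "cin x ((qs2 ! a + qs2 ! b - ?E) *v x) \<in> \<real>\<^sub>\<ge>\<^sub>0" for x
  proof (cases "a = b")
    case True
    hence "qs2 ! a + qs2 ! b - ?E = qs2 ! a + (N - ?E)"
      by (simp add: N_def)
    hence "cin x ((qs2 ! a + qs2 ! b - ?E) *v x) = cin x (qs2 ! a *v x) + cin x ((N - ?E) *v x)"
      by (simp only: matrix_vector_mult_add_rdistrib cin_add_right)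
    thus ?thesis
      using 1[of x] 2[of x] by (simp add: nonneg_Reals_add_I)
  next
    case False
    thus ?thesis
      using 1[of x] by (simp add: N_def)
  qed
  hence "op_le (\<phi> (mat 1)) (qs2 ! a + qs2 ! b)"
    by (simp add: op_le_iff \<phi>[OF mat1_in_nest_alg[OF nest1]])
  thus ?thesis
    using ab nth_mem unfolding T2_degenerate_def by blast
qed

end

section \<open>Monotone atom maps of an irreducible embedding\<close>

text \<open>Here \<open>\<sigma> i\<close> is the atom map of the \<open>i\<close>-th summand on the atoms \<open>0, \<dots>, L\<close>, and \<open>A\<close>, \<open>B\<close> are the
  restrictions forced by order conservation. The summands whose range \<open>{\<sigma> i 0..\<sigma> i L}\<close> is
  lexicographically least precede all others, so by irreducibility all ranges agree.\<close>

lemma atom_maps_dichotomy: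
  fixes \<sigma> :: "nat \<Rightarrow> nat \<Rightarrow> nat"
  assumes r: "0 < r"
    and mono: "\<And>i k k'. i < r \<Longrightarrow> k \<le> k' \<Longrightarrow> k' \<le> L \<Longrightarrow> \<sigma> i k \<le> \<sigma> i k'"
    and A: "\<And>i j k. i < r \<Longrightarrow> j < r \<Longrightarrow> k \<le> L \<Longrightarrow> \<sigma> i k < \<sigma> j k \<Longrightarrow> \<sigma> i L \<le> \<sigma> j k"
    and B: "\<And>i j k. i < r \<Longrightarrow> j < r \<Longrightarrow> k \<le> L \<Longrightarrow> \<sigma> i k < \<sigma> j k \<Longrightarrow> \<sigma> i k \<le> \<sigma> j 0"
    and irr: "\<And>S. S \<subseteq> {..<r} \<Longrightarrow> S \<noteq> {} \<Longrightarrow>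
      (\<And>i j. i \<in> S \<Longrightarrow> j < r \<Longrightarrow> j \<notin> S \<Longrightarrow> \<sigma> i L \<le> \<sigma> j 0) \<Longrightarrow> S = {..<r}"
  shows "(\<exists>i<r. \<forall>h<r. \<forall>k\<le>L. \<sigma> h k = \<sigma> i 0 \<or> \<sigma> h k = \<sigma> i L) \<or>
    (\<forall>i<r. \<forall>j<r. \<forall>k\<le>L. \<sigma> i k = \<sigma> j k)"
proof -
  obtain i1 where i1: "i1 < r" "\<And>j. j < r \<Longrightarrow> \<sigma> i1 0 \<le> \<sigma> j 0"
    using ex_has_least_nat[of "\<lambda>i. i < r" 0 "\<lambda>i. \<sigma> i 0"] r by blast
  define a where "a = \<sigma> i1 0"
  obtain i0 where i0: "i0 < r" "\<sigma> i0 0 = a"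
    "\<And>j. j < r \<Longrightarrow> \<sigma> j 0 = a \<Longrightarrow> \<sigma> i0 L \<le> \<sigma> j L"
    using ex_has_least_nat[of "\<lambda>i. i < r \<and> \<sigma> i 0 = a" i1 "\<lambda>i. \<sigma> i L"] i1(1) a_def by blast
  define b where "b = \<sigma> i0 L"
  \<comment> \<open>A summand outside this set starts after a, where \<open>A\<close> at k = 0
    applies, or starts at a and ends after b, where \<open>B\<close> at k = L applies. Either way
    its start is at least b.\<close>
  have "{i. i < r \<and> \<sigma> i 0 = a \<and> \<sigma> i L = b} = {..<r}"
  proof (rule irr)
    fix i j
    assume i: "i \<in> {i. i < r \<and> \<sigma> i 0 = a \<and> \<sigma> i L = b}" and j: "j < r"
      "j \<notin> {i. i < r \<and> \<sigma> i 0 = a \<and> \<sigma> i L = b}"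
    show "\<sigma> i L \<le> \<sigma> j 0"
    proof (cases "\<sigma> j 0 = a")
      case True
      hence "\<sigma> i L < \<sigma> j L"
        using i j i0(3)[of j] by (auto simp: b_def)
      thus ?thesis
        using B[of i j L] i j by simp
    next
      case False
      hence "\<sigma> i 0 < \<sigma> j 0"
        using i j i1(2)[of j] by (simp add: a_def)
      thus ?thesis
        using A[of i j 0] i j by simp
    qed
  qed (use i0 b_def in auto)
  hence ends: "\<sigma> i 0 = a" "\<sigma> i L = b" if "i < r" for i
    using that by auto
  show ?thesis
  proof (cases "\<forall>i<r. \<forall>j<r. \<forall>k\<le>L. \<sigma> i k = \<sigma> j k")
    case False
    then obtain i j k where ij: "i < r" "j < r" "k \<le> L" "\<sigma> i k < \<sigma> j k"
      by (metis nat_neq_iff)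
    have bounds: "a \<le> \<sigma> h l" "\<sigma> h l \<le> b" if "h < r" "l \<le> L" for h l
      using mono[of h 0 l] mono[of h l L] ends[of h] that by auto
    have ik: "\<sigma> i k = a"
      using B[OF ij] ends ij bounds[of i k] by simp
    have jk: "\<sigma> j k = b"
      using A[OF ij] ends ij bounds[of j k] by simp
    have "\<sigma> h l = a \<or> \<sigma> h l = b" if h: "h < r" and l: "l \<le> L" for h l
    proof (rule ccontr)
      assume "\<not> ?thesis"
      hence c: "a < \<sigma> h l" "\<sigma> h l < b"
        using bounds[OF h l] by auto
      \<comment> \<open>A strictly intermediate value at l must be shared by all summands: a smaller
        value at l elsewhere would push it up to b by \<open>A\<close>, a larger one down to a by
        \<open>B\<close>.\<close>
      have eq: "\<sigma> g l = \<sigma> h l" if g: "g < r" for g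
      proof (rule linorder_cases)
        assume "\<sigma> g l < \<sigma> h l"
        thus ?thesis using A[OF g h l] ends[OF g] c by simp
      next
        assume "\<sigma> h l < \<sigma> g l"
        thus ?thesis using B[OF h g l] ends[OF g] c by simp
      qed
      \<comment> \<open>At k summand i is still at a while summand j has reached b. A common
        intermediate value at l contradicts the monotonicity of i if l <= k, and that of j
        otherwise.\<close>
      show False
      proof (cases "l \<le> k")
        case True
        thus False
          using mono[OF ij(1) True ij(3)] eq[OF ij(1)] ik c by simp
      next
        case False
        thus False
          using mono[OF ij(2) _ l, of k] eq[OF ij(2)] jk c by simp
      qed
    qed
    hence "\<forall>h<r. \<forall>l\<le>L. \<sigma> h l = \<sigma> i 0 \<or> \<sigma> h l = \<sigma> i L"
      by (simp add: ends[OF ij(1)])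
    thus ?thesis
      using ij(1) by blast
  qed (rule disjI2)
qed

section \<open>Refinement type\<close>

text \<open>Parseval's identity, used to add up the squared moduli of all entries of a rank one
  matrix.\<close>

lemma onb_norm_expand:
  assumes "onb xs"
  shows "cin y y = (\<Sum>i<length xs. cnj (cin (xs ! i) y) * cin (xs ! i) y)"
proof -
  have "cin y y = cin y (\<Sum>i<length xs. cin (xs ! i) y *s xs ! i)"
    by (simp add: onb_expand[OF assms])
  also have "\<dots> = (\<Sum>i<length xs. cin (xs ! i) y * cin y (xs ! i))"
    by (simp add: cin_sum_right)
  also have "\<dots> = (\<Sum>i<length xs. cnj (cin (xs ! i) y) * cin (xs ! i) y)"
    by (intro sum.cong refl) (subst cin_commute, simp)
  finally show ?thesis .
qed

text \<open>Over rank one atoms this turns the blockwise condition in \<open>pisom_reg\<close> into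
  a condition on matrix entries.\<close>

lemma partial_isometry_cscale_outer:
  assumes "cin x x = 1" "cin y y = 1"
  shows "partial_isometry (cscale c (outer x y)) \<longleftrightarrow> c = 0 \<or> cmod c = 1"
proof -
  have nz: "outer x y \<noteq> 0"
    using assms by (intro outer_nonzero unit_nonzero)
  have eq_iff: "cscale d (outer x y) = cscale e (outer x y) \<longleftrightarrow> d = e" for d e
    using nz by (auto simp: cscale_def vec_eq_iff)
  have "cscale c (outer x y) ** ct (cscale c (outer x y)) ** cscale c (outer x y)
      = cscale (c * (cnj c * c)) (outer x y)"
    using assms by (simp add: ct_cscale cscale_mult_left cscale_mult_right cscale_cscale mult_outer
        cscale_mult_vec outer_scale_left mult_ac)
  hence "partial_isometry (cscale c (outer x y)) \<longleftrightarrow> c * (cnj c * c) = c"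
    by (simp add: partial_isometry_iff eq_iff)
  also have "\<dots> \<longleftrightarrow> c = 0 \<or> cnj c * c = 1"
    by auto
  also have "cnj c * c = 1 \<longleftrightarrow> cmod c = 1"
  proof -
    have "cnj c * c = of_real ((cmod c)\<^sup>2)"
      by (simp add: complex_norm_square mult.commute del: of_real_power)
    hence "cnj c * c = 1 \<longleftrightarrow> (cmod c)\<^sup>2 = 1"
      by (metis of_real_1 of_real_eq_iff)
    thus ?thesis
      using norm_ge_zero[of c] by (auto simp: power2_eq_1_iff)
  qed
  finally show ?thesis .
qed

text \<open>All entries of such a \<open>v\<close> have modulus 0 or 1, while their squared moduli add up to 1.\<close>

lemma rank_one_pisom_reg_vector_atoms:
  assumes xs: "onb xs" and v: "v \<in> pisom_reg (vector_atoms xs)" "rank v = 1"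
  obtains c j k where "j < length xs" "k < length xs" "cmod c = 1" "v = cscale c (outer (xs ! j) (xs ! k))"
proof -
  define n where "n = length xs"
  define e where "e j k = cin (xs ! j) (v *v xs ! k)" for j k
  obtain \<xi> \<eta> where \<xi>\<eta>: "v = outer \<xi> \<eta>"
    by (rule rank_one_outer[OF v(2)])
  have unit: "cin (xs ! j) (xs ! j) = 1" if "j < n" for j
    using onb_cin[OF xs] that by (simp add: n_def)
  have e01: "e j k = 0 \<or> cmod (e j k) = 1" if "j < n" "k < n" for j k
    using v(1) that partial_isometry_cscale_outer[OF unit unit]
    unfolding pisom_reg_def e_def n_def
    by (simp add: vector_atoms_block del: nth_vector_atoms)
  have v0: "v \<noteq> 0"
    using v(2) by (auto simp: row_rank_def_gen rows_def row_def)
  \<comment> \<open>The scalar is the product of the squared norms of \<xi> and \<eta>, which is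
    also the sum of the squared moduli of the entries of v.\<close>
  have "v ** ct v ** v = cscale (cin \<xi> \<xi> * cin \<eta> \<eta>) v"
    by (simp add: \<xi>\<eta> mult_outer outer_scale_left cscale_mult_vec mult_ac cscale_cscale)
  moreover have "v ** ct v ** v = v"
    using v(1) by (simp add: pisom_reg_def partial_isometry_iff)
  ultimately have "cscale (cin \<xi> \<xi> * cin \<eta> \<eta>) v = v" by simp
  hence one: "cin \<xi> \<xi> * cin \<eta> \<eta> = 1"
    using v0 by (auto simp: cscale_def vec_eq_iff)
  have ek: "e j k = cin \<eta> (xs ! k) * cin (xs ! j) \<xi>" for j k
    by (simp add: e_def \<xi>\<eta>)
  have "(\<Sum>(j, k)\<in>{..<n} \<times> {..<n}. cnj (e j k) * e j k)
      = (\<Sum>j<n. \<Sum>k<n. (cnj (cin (xs ! j) \<xi>) * cin (xs ! j) \<xi>) * (cnj (cin (xs ! k) \<eta>) * cin (xs ! k) \<eta>))"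
    unfolding sum.cartesian_product[symmetric] ek
    by (intro sum.cong refl, subst (1 2) cin_commute[of \<eta>]) (simp add: mult_ac)
  also have "\<dots> = cin \<xi> \<xi> * cin \<eta> \<eta>"
    unfolding onb_norm_expand[OF xs, folded n_def] by (simp add: sum_product)
  finally have "(\<Sum>(j, k)\<in>{..<n} \<times> {..<n}. cnj (e j k) * e j k) = 1"
    by (simp add: one)
  moreover have "cnj (e j k) * e j k = of_real ((cmod (e j k))\<^sup>2)" for j k
    by (simp add: complex_norm_square mult.commute del: of_real_power)
  ultimately have "complex_of_real (\<Sum>(j, k)\<in>{..<n} \<times> {..<n}. (cmod (e j k))\<^sup>2) = of_real 1"
    by (simp add: case_prod_unfold)
  hence sum1: "(\<Sum>(j, k)\<in>{..<n} \<times> {..<n}. (cmod (e j k))\<^sup>2) = 1"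
    by (simp only: of_real_eq_iff)
  have "\<exists>(j, k)\<in>{..<n} \<times> {..<n}. e j k \<noteq> 0"
  proof (rule ccontr)
    assume "\<not> ?thesis"
    hence "(\<Sum>(j, k)\<in>{..<n} \<times> {..<n}. (cmod (e j k))\<^sup>2) = 0"
      by (intro sum.neutral) auto
    thus False using sum1 by simp
  qed
  then obtain j k where jk: "j < n" "k < n" "e j k \<noteq> 0" by auto
  have norm1: "cmod (e j k) = 1"
    using e01 jk by auto
  have "(\<Sum>(j', k')\<in>{..<n} \<times> {..<n} - {(j, k)}. (cmod (e j' k'))\<^sup>2) = 0"
    using sum1 sum.remove[of "{..<n} \<times> {..<n}" "(j, k)" "\<lambda>(j, k). (cmod (e j k))\<^sup>2"] jk norm1 by simp
  hence zero: "\<forall>u\<in>{..<n} \<times> {..<n} - {(j, k)}. (case u of (j', k') \<Rightarrow> (cmod (e j' k'))\<^sup>2) = 0"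
    by (subst (asm) sum_nonneg_eq_0_iff) auto
  have other: "e j' k' = 0" if "j' < n" "k' < n" "(j', k') \<noteq> (j, k)" for j' k'
    using bspec[OF zero, of "(j', k')"] that by auto
  have "v = cscale (e j k) (outer (xs ! j) (xs ! k))"
  proof (rule onb_matrix_eqI[OF xs xs])
    fix j' k' assume "j' < length xs" "k' < length xs"
    thus "cin (xs ! j') (v *v xs ! k') = cin (xs ! j') (cscale (e j k) (outer (xs ! j) (xs ! k)) *v xs ! k')"
      using other[of j' k'] jk
      by (auto simp: cscale_mult_vec onb_cin[OF xs] n_def simp flip: e_def)
  qed
  thus ?thesis
    using that jk norm1 by (simp add: n_def)
qed

text \<open>Positional notation with base K: sort keys are natural numbers, and a last digit below K
  cannot overturn a strict comparison of the leading parts.\<close>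

lemma lex_less: "a < a' \<Longrightarrow> b < K \<Longrightarrow> a * K + b < a' * K + b'" for a :: nat
proof -
  assume "a < a'" "b < K"
  have "a * K + b < Suc a * K" using \<open>b < K\<close> by simp
  also have "\<dots> \<le> a' * K" using \<open>a < a'\<close> by (intro mult_right_mono) auto
  finally show ?thesis by simp
qed

text \<open>In the locale below \<open>xs\<close> and \<open>ys\<close> are bases of the two spaces: \<open>ys\<close> contains the images of \<open>xs\<close> under
  the isometries, those of \<open>xs ! j\<close> before those of \<open>xs ! j'\<close> if \<open>j < j'\<close>, and for fixed \<open>j\<close> in the
  order of the summands.\<close>

locale refining_bases = isometry_sum qs1 qs2 r U
  for qs1 :: "(complex^'n^'n) list" and qs2 :: "(complex^'m^'m) list"
    and r :: nat and U :: "nat \<Rightarrow> complex^'n^'m" +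
  fixes xs :: "(complex^'n) list" and ys :: "(complex^'m) list"
  assumes onb_xs: "onb xs" and onb_ys: "onb ys"
    and image: "i < r \<Longrightarrow> j < length xs \<Longrightarrow> U i *v xs ! j \<in> set ys"
    and ordered: "i < r \<Longrightarrow> i' < r \<Longrightarrow> j < length xs \<Longrightarrow> j' < length xs \<Longrightarrow>
      p < length ys \<Longrightarrow> q < length ys \<Longrightarrow> ys ! p = U i *v xs ! j \<Longrightarrow> ys ! q = U i' *v xs ! j' \<Longrightarrow>
      j < j' \<or> j = j' \<and> i < i' \<Longrightarrow> p < q"
begin

lemma basis_index:
  assumes "p < length ys" "i < r" "j < length xs" "cin (ys ! p) (U i *v xs ! j) \<noteq> 0"
  shows "ys ! p = U i *v xs ! j"
proof -
  obtain q where "q < length ys" "ys ! q = U i *v xs ! j"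
    using image[OF assms(2,3)] by (auto simp: in_set_conv_nth)
  thus ?thesis
    using assms(1,4) onb_cin[OF onb_ys, of p q] by (auto split: if_splits)
qed

text \<open>Since \<open>ys\<close> contains the images of the basis \<open>xs\<close> under U_i,
  its remaining vectors are orthogonal to the range of U_i.\<close>

lemma ct_isometry_basis:
  assumes "p < length ys" "i < r"
  obtains "ct (U i) *v ys ! p = 0" | j where "j < length xs" "ys ! p = U i *v xs ! j"
proof (cases "\<exists>j<length xs. ys ! p = U i *v xs ! j")
  case True
  thus ?thesis using that(2) by blast
next
  case False
  have "cin (xs ! j) (ct (U i) *v ys ! p) = 0" if "j < length xs" for j
    using basis_index[OF assms that] False that cin_eq0_commute[of "ys ! p"]
    by (auto simp flip: cin_adjoint')
  hence "ct (U i) *v ys ! p = 0"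
    by (intro onb_vec_eqI[OF onb_xs]) simp
  thus ?thesis using that(1) by blast
qed

text \<open>Relative to \<open>ys\<close> the matrix of the sum consists of r copies of the matrix
  of a relative to \<open>xs\<close>, on disjoint sets of indices, and of zeros elsewhere.\<close>

lemma conj_sum_entry:
  assumes p: "p < length ys" and q: "q < length ys"
    and nz: "cin (ys ! p) (conj_sum {..<r} a *v ys ! q) \<noteq> 0"
  obtains i j k where "i < r" "j < length xs" "k < length xs"
    "ys ! p = U i *v xs ! j" "ys ! q = U i *v xs ! k"
    "cin (ys ! p) (conj_sum {..<r} a *v ys ! q) = cin (xs ! j) (a *v xs ! k)"
proof -
  have "cin (ys ! p) (conj_sum {..<r} a *v ys ! q)
      = (\<Sum>i<r. cin (ct (U i) *v ys ! p) (a *v (ct (U i) *v ys ! q)))"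
    by (simp add: conj_sum_def sum_mult_vec cin_sum_right mult_vec_assoc cin_adjoint[of _ "U _"])
  then obtain i where i: "i < r" "cin (ct (U i) *v ys ! p) (a *v (ct (U i) *v ys ! q)) \<noteq> 0"
    using nz by (metis (no_types, lifting) lessThan_iff sum.neutral)
  obtain j where j: "j < length xs" "ys ! p = U i *v xs ! j"
    using ct_isometry_basis[OF p i(1)] i(2) by (metis cin_zero_left)
  obtain k where k: "k < length xs" "ys ! q = U i *v xs ! k"
    using ct_isometry_basis[OF q i(1)] i(2) by (metis cin_zero_right matrix_vector_mult_0_right)
  have "conj_sum {..<r} a *v ys ! q = U i *v (a *v xs ! k)"
    unfolding k(2) using i(1) by (simp add: conj_sum_vec)
  hence "cin (ys ! p) (conj_sum {..<r} a *v ys ! q) = cin (xs ! j) (a *v xs ! k)"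
    unfolding j(2) using i(1) by (simp add: iso_cin)
  thus ?thesis
    using that i(1) j k by blast
qed

lemma ordered_le:
  assumes "i < r" "i' < r" "j < length xs" "j' < length xs" "p < length ys" "q < length ys"
    "ys ! p = U i *v xs ! j" "ys ! q = U i' *v xs ! j'" "j < j' \<or> j = j' \<and> i \<le> i'"
  shows "p \<le> q"
proof (cases "j = j' \<and> i = i'")
  case True
  hence "ys ! p = ys ! q" using assms by simp
  hence "p = q"
    using onb_cin[OF onb_ys assms(5,6)] onb_cin[OF onb_ys assms(6,6)] by (simp split: if_splits)
  thus ?thesis by simp
next
  case False
  thus ?thesis
    using ordered[OF assms(1-8)] assms(9) by linarith
qed

lemma conj_sum_nest_alg:
  assumes "a \<in> nest_alg (vector_atoms xs)"
  shows "conj_sum {..<r} a \<in> nest_alg (vector_atoms ys)"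
  unfolding nest_alg_vector_atoms[OF onb_ys]
proof (intro allI impI, rule ccontr)
  fix p q assume p: "p < length ys" and q: "q < p"
    and nz: "cin (ys ! p) (conj_sum {..<r} a *v ys ! q) \<noteq> 0"
  have q': "q < length ys" using p q by simp
  obtain i j k where ijk: "i < r" "j < length xs" "k < length xs"
    "ys ! p = U i *v xs ! j" "ys ! q = U i *v xs ! k" "cin (xs ! j) (a *v xs ! k) \<noteq> 0"
    using conj_sum_entry[OF p q' nz] nz by metis
  have "j \<le> k"
    using assms ijk(2,6) unfolding nest_alg_vector_atoms[OF onb_xs] by (meson not_le)
  hence "p \<le> q"
    using ordered_le[OF ijk(1,1,2,3) p q' ijk(4,5)] by linarith
  thus False using q by simp
qed

text \<open>Up to a unimodular factor v is a matrix unit (j,k), and its image has one entry for each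
  summand i, in the row of U_i x_j and the column of U_i x_k. Rows and columns both increase with i,
  so no entry is strictly nested in another.\<close>

lemma conj_sum_pisom_oc:
  assumes v: "v \<in> pisom_reg (vector_atoms xs)" "rank v = 1"
  shows "conj_sum {..<r} v \<in> pisom_oc (vector_atoms ys)"
proof -
  let ?w = "conj_sum {..<r} v"
  obtain c j k where jk: "j < length xs" "k < length xs" "cmod c = 1"
    "v = cscale c (outer (xs ! j) (xs ! k))"
    by (rule rank_one_pisom_reg_vector_atoms[OF onb_xs v])
  have entry: "cin (xs ! j') (v *v xs ! k') = (if j' = j \<and> k' = k then c else 0)"
    if "j' < length xs" "k' < length xs" for j' k'
    using that jk by (simp add: cscale_mult_vec onb_cin[OF onb_xs])
  have entry': "\<exists>i<r. ys ! p = U i *v xs ! j \<and> ys ! q = U i *v xs ! k"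
    "cmod (cin (ys ! p) (?w *v ys ! q)) = 1"
    if pq: "p < length ys" "q < length ys" and nz: "cin (ys ! p) (?w *v ys ! q) \<noteq> 0" for p q
    using conj_sum_entry[OF pq nz] nz entry jk(3) by metis+
  have "v ** ct v ** v = v"
    using v(1) by (simp add: pisom_reg_def partial_isometry_iff)
  hence "partial_isometry ?w"
    using conj_sum_star_hom[of "{..<r}"]
    unfolding partial_isometry_iff star_hom_def adj_eq_ct by (metis order.refl)
  moreover have "partial_isometry (vector_atoms ys ! p ** ?w ** vector_atoms ys ! q)"
    if pq: "p < length ys" "q < length ys" for p q
    unfolding vector_atoms_block[OF pq]
    using entry'(2)[OF pq] onb_cin[OF onb_ys pq(1,1)] onb_cin[OF onb_ys pq(2,2)]
    by (subst partial_isometry_cscale_outer) auto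
  moreover have "?w \<in> nest_alg (vector_atoms ys)"
    using v by (intro conj_sum_nest_alg) (simp add: pisom_reg_def)
  moreover have "vector_atoms ys ! s ** ?w ** vector_atoms ys ! t = 0"
    if pq: "p < length ys" "q < length ys" and nz: "vector_atoms ys ! p ** ?w ** vector_atoms ys ! q \<noteq> 0"
      and st: "s < p" "q < t" "t < length ys" for p q s t
  proof (rule ccontr)
    have s: "s < length ys" using st pq by simp
    assume nz': "vector_atoms ys ! s ** ?w ** vector_atoms ys ! t \<noteq> 0"
    obtain i where i: "i < r" "ys ! p = U i *v xs ! j" "ys ! q = U i *v xs ! k"
      using entry'(1)[OF pq] nz vector_atoms_block_eq0[OF onb_ys pq] by blast
    obtain i' where i': "i' < r" "ys ! s = U i' *v xs ! j" "ys ! t = U i' *v xs ! k"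
      using entry'(1)[OF s st(3)] nz' vector_atoms_block_eq0[OF onb_ys s st(3)] by blast
    show False
    proof (cases "i \<le> i'")
      case True
      thus False
        using ordered_le[OF i(1) i'(1) jk(1,1) pq(1) s i(2) i'(2)] st True by simp
    next
      case False
      thus False
        using ordered_le[OF i'(1) i(1) jk(2,2) st(3) pq(2) i'(3) i(3)] st False by simp
    qed
  qed
  ultimately show ?thesis
    unfolding pisom_oc_def pisom_reg_def mem_Collect_eq length_vector_atoms by blast
qed

text \<open>Otherwise the form of the difference, evaluated at the vector \<open>ys ! p\<close>
  itself, would be 0 - 1.\<close>

lemma op_le_conj_sum_atom:
  assumes p: "p < length ys" and j: "j < length xs"
    and le: "op_le (vector_atoms ys ! p) (conj_sum {..<r} (vector_atoms xs ! j))"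
  shows "\<exists>i<r. ys ! p = U i *v xs ! j"
proof (rule ccontr)
  assume neg: "\<not> ?thesis"
  have "cin (ys ! p) (conj_sum {..<r} (vector_atoms xs ! j) *v ys ! p) = 0"
  proof (rule ccontr)
    assume nz: "\<not> ?thesis"
    obtain i j' k where ijk: "i < r" "j' < length xs" "k < length xs" "ys ! p = U i *v xs ! j'"
      "cin (xs ! j') (vector_atoms xs ! j *v xs ! k) \<noteq> 0"
      using conj_sum_entry[OF p p nz] nz by metis
    hence "j' = j"
      using j by (auto simp: onb_cin[OF onb_xs] split: if_splits)
    thus False using neg ijk by blast
  qed
  hence "cin (ys ! p) ((conj_sum {..<r} (vector_atoms xs ! j) - vector_atoms ys ! p) *v ys ! p) = -1"
    using p by (simp add: matrix_vector_mult_diff_rdistrib cin_diff_right onb_cin[OF onb_ys])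
  hence "(-1 :: complex) \<in> \<real>\<^sub>\<ge>\<^sub>0"
    using le unfolding op_le_iff by metis
  thus False
    by (simp add: complex_nonneg_Reals_iff)
qed

end

text \<open>Equality of the atom maps makes the A2-atom of U_i x_j a nondecreasing function of j
  alone. Sorting by atom, as containment in A2 demands, is therefore compatible with sorting the
  images by j and then by i, as refinement demands.\<close>

lemma (in isometry_sum) refinement_typeI:
  assumes \<phi>: "\<And>a. a \<in> nest_alg qs1 \<Longrightarrow> \<phi> a = conj_sum {..<r} a"
    and emb: "star_extendible_embedding (nest_alg qs1) (nest_alg qs2) \<phi>"
    and eq: "\<And>i j k. i < r \<Longrightarrow> j < r \<Longrightarrow> k < length qs1 \<Longrightarrow> atom_map i k = atom_map j k"
  shows "refinement_type qs1 qs2 \<phi>"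
proof -
  define pos1 where "pos1 x = (LEAST s. s < length qs1 \<and> qs1 ! s *v x = x)" for x
  define pos2 where "pos2 y = (LEAST s. s < length qs2 \<and> qs2 ! s *v y = y)" for y
  obtain B1 where B1: "finite B1" "orthonormal B1" "(\<Sum>b\<in>B1. outer b b) = mat 1"
    "\<And>x. x \<in> B1 \<Longrightarrow> \<exists>s<length qs1. qs1 ! s *v x = x"
    using adapted_orthonormal_extension[OF nest1, of "{}"] by (auto simp: orthonormal_def)
  obtain xs where xs: "onb xs" "set xs = B1"
    "\<And>i j. i \<le> j \<Longrightarrow> j < length xs \<Longrightarrow> pos1 (xs ! i) \<le> pos1 (xs ! j)"
    using orthonormal_sorted_list[OF B1(1-3), of pos1] by metis
  define n where "n = length xs"
  define blk where "blk j = pos1 (xs ! j)" for j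
  have blk: "blk j < length qs1" "qs1 ! blk j *v xs ! j = xs ! j" if "j < n" for j
    using B1(4)[of "xs ! j"] LeastI_ex[of "\<lambda>s. s < length qs1 \<and> qs1 ! s *v xs ! j = xs ! j"] that xs(2)
    by (auto simp: blk_def pos1_def n_def)
  have blk_mono: "blk i \<le> blk j" if "i \<le> j" "j < n" for i j
    using xs(3) that by (simp add: blk_def n_def)
  define f where "f = (\<lambda>(i, j). U i *v xs ! j)"
  define I where "I = {..<r} \<times> {..<n}"
  have cin_f: "cin (f u) (f w) = (if u = w then 1 else 0)" if "u \<in> I" "w \<in> I" for u w
    using that onb_cin[OF xs(1)] by (auto simp: I_def f_def iso_cin n_def split: if_splits)
  have inj: "inj_on f I"
    by (rule inj_onI) (metis cin_f zero_neq_one)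
  have f_pos: "atom_map i (blk j) < length qs2 \<and> qs2 ! atom_map i (blk j) *v f (i, j) = f (i, j)"
    if "i < r" "j < n" for i j
    using atom_map[OF that(1) blk(1)[OF that(2)]] blk(2)[OF that(2)] by (simp add: f_def)
  have "orthonormal (f ` I)"
    using cin_f inj by (auto simp: orthonormal_def inj_on_eq_iff)
  moreover have "\<exists>s<length qs2. qs2 ! s *v x = x" if "x \<in> f ` I" for x
    using that f_pos by (auto simp: I_def)
  ultimately obtain B2 where B2: "f ` I \<subseteq> B2" "finite B2" "orthonormal B2"
    "(\<Sum>b\<in>B2. outer b b) = mat 1" "\<And>y. y \<in> B2 \<Longrightarrow> \<exists>s<length qs2. qs2 ! s *v y = y"
    using adapted_orthonormal_extension[OF nest2, of "f ` I"] by (auto simp: I_def)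
  have pos2: "pos2 y < length qs2" "qs2 ! pos2 y *v y = y" if "y \<in> B2" for y
    using LeastI_ex[OF B2(5)[OF that]] by (auto simp: pos2_def)
  have pos2_eq: "pos2 y = s" if "s < length qs2" "qs2 ! s *v y = y" "y \<noteq> 0" "y \<in> B2" for s y
    using nest_atom_vec[OF nest2 pos2(1)[OF that(4)] that(1,2)] pos2(2)[OF that(4)] that(3) by (auto split: if_splits)
  \<comment> \<open>Vectors outside the images get the default (0, n); as n exceeds every index j,
    they follow the images within their atom. The bases \<open>Suc n\<close> and
    \<open>Suc r\<close> of the key leave room for the default digits, also when r = 0.\<close>
  define g where "g y = (if y \<in> f ` I then inv_into I f y else (0, n))" for y
  define key where "key y = (pos2 y * Suc n + snd (g y)) * Suc r + fst (g y)" for y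
  have g: "g (f (i, j)) = (i, j)" if "i < r" "j < n" for i j
    using that inj by (simp add: g_def I_def)
  have g_bound: "snd (g y) < Suc n" "fst (g y) < Suc r" for y
    using inv_into_into[of y f I] by (auto simp: g_def I_def less_Suc_eq)
  obtain ys where ys: "onb ys" "set ys = B2"
    "\<And>p q. p \<le> q \<Longrightarrow> q < length ys \<Longrightarrow> key (ys ! p) \<le> key (ys ! q)"
    using orthonormal_sorted_list[OF B2(2-4), of key] by metis
  have key_pos2: "pos2 y \<le> pos2 z" if "key y \<le> key z" for y z
  proof (rule ccontr)
    assume "\<not> pos2 y \<le> pos2 z"
    hence "pos2 z * Suc n + snd (g z) < pos2 y * Suc n + snd (g y)"
      using g_bound by (intro lex_less) auto
    hence "key z < key y"
      unfolding key_def by (rule lex_less[OF _ g_bound(2)])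
    thus False using that by simp
  qed
  have key_less: "key (f (i, j)) < key (f (i', j'))"
    if ij: "i < r" "i' < r" "j < n" "j' < n" and less: "j < j' \<or> j = j' \<and> i < i'" for i i' j j'
  proof -
    have pos: "pos2 (f (i, j)) = atom_map i (blk j)" if "i < r" "j < n" for i j
    proof (rule pos2_eq)
      show "f (i, j) \<noteq> 0"
        using cin_f[of "(i, j)" "(i, j)"] that by (intro unit_nonzero) (simp add: I_def)
      show "f (i, j) \<in> B2"
        using B2(1) that by (auto simp: I_def)
    qed (use f_pos[OF that] in auto)
    \<comment> \<open>Monotonicity compares j with j' within summand i; \<open>eq\<close> passes
      from i to i'.\<close>
    have "atom_map i (blk j) \<le> atom_map i' (blk j')"
      using atom_map_mono[of i "blk j" "blk j'"] blk_mono[of j j'] blk(1)[of j'] eq[of i i' "blk j'"] ij less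
      by auto
    show ?thesis
    proof (cases "j = j'")
      case True
      thus ?thesis
        using less ij eq[of i i' "blk j"] blk(1)[of j] by (simp add: key_def pos g)
    next
      case False
      hence "atom_map i (blk j) * Suc n + j < atom_map i' (blk j') * Suc n + j'"
        using less \<open>atom_map i (blk j) \<le> _\<close> by (intro add_le_less_mono mult_right_mono) auto
      thus ?thesis
        unfolding key_def pos[OF ij(1,3)] pos[OF ij(2,4)] g[OF ij(1,3)] g[OF ij(2,4)] fst_conv snd_conv
        by (rule lex_less) (use ij in simp)
    qed
  qed
  interpret refining_bases qs1 qs2 r U xs ys
  proof
    fix i j assume "i < r" "j < length xs"
    thus "U i *v xs ! j \<in> set ys"
      using B2(1) ys(2) by (force simp: I_def f_def n_def)
  next
    fix i i' j j' p q
    assume "i < r" "i' < r" "j < length xs" "j' < length xs" "p < length ys" "q < length ys"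
      "ys ! p = U i *v xs ! j" "ys ! q = U i' *v xs ! j'" "j < j' \<or> j = j' \<and> i < i'"
    thus "p < q"
      using key_less[of i i' j j'] ys(3)[of q p] by (force simp: f_def n_def not_less)
  qed (use xs(1) ys(1) in auto)
  let ?es = "vector_atoms xs" and ?fs = "vector_atoms ys"
  have max1: "maximal_triangular_in (nest_alg ?es) (nest_alg qs1)"
    using blk blk_mono by (intro vector_atoms_maximal_triangular[OF nest1 xs(1), of blk]) (auto simp: n_def)
  have max2: "maximal_triangular_in (nest_alg ?fs) (nest_alg qs2)"
    using pos2 ys(2) key_pos2 ys(3)
    by (intro vector_atoms_maximal_triangular[OF nest2 ys(1), of "\<lambda>p. pos2 (ys ! p)"]) auto
  have sub: "nest_alg ?es \<subseteq> nest_alg qs1"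
    using max1 by (simp add: maximal_triangular_in_def)
  hence \<phi>': "\<phi> a = conj_sum {..<r} a" if "a \<in> nest_alg ?es" for a
    using \<phi> that by blast
  hence maps: "\<phi> ` nest_alg ?es \<subseteq> nest_alg ?fs"
    using conj_sum_nest_alg by auto
  have "star_extendible_embedding (nest_alg ?es) (nest_alg ?fs) \<phi>"
    using emb maps sub inj_on_subset[of \<phi> "nest_alg qs1" "nest_alg ?es"]
    unfolding star_extendible_embedding_def star_extendible_def star_extension_def by blast
  moreover have "locally_order_conserving ?es ?fs \<phi>"
    using conj_sum_pisom_oc \<phi>' by (auto simp: locally_order_conserving_def pisom_reg_def)
  moreover have "s < t"
    if less: "i < j" "j < length xs" "s < length ys" "t < length ys"
      "op_le (?fs ! s) (\<phi> (?es ! i))" "op_le (?fs ! t) (\<phi> (?es ! j))" for i j s t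
  proof -
    have i: "i < length xs" using less by simp
    have atom: "\<phi> (?es ! k) = conj_sum {..<r} (?es ! k)" if "k < length xs" for k
      using outer_in_nest_alg_vector_atoms[OF xs(1) order.refl that] that by (intro \<phi>') simp
    obtain h where h: "h < r" "ys ! s = U h *v xs ! i"
      using op_le_conj_sum_atom[OF less(3) i] less(5) unfolding atom[OF i] by blast
    obtain h' where h': "h' < r" "ys ! t = U h' *v xs ! j"
      using op_le_conj_sum_atom[OF less(4,2)] less(6) unfolding atom[OF less(2)] by blast
    show "s < t"
      using ordered[OF h(1) h'(1) i less(2-4) h(2) h'(2)] less(1) by simp
  qed
  ultimately have "refinement_type_triangular ?es ?fs \<phi>"
    unfolding refinement_type_triangular_def length_vector_atoms by blast
  thus ?thesis
    using max1 max2 maps onb_rank_one_atoms[OF xs(1)] onb_rank_one_atoms[OF ys(1)]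
    unfolding refinement_type_def by blast
qed

section \<open>The theorem\<close>

text \<open>The summands have orthogonal range projections U_i U_i^* at 1; multiplying such a
  product by U_i^* on the left and by U_j on the right gives U_i^* U_j = 0.\<close>

lemma regular_isometry_sum:
  assumes "nest_atoms qs1" "nest_atoms qs2" "regular (nest_alg qs1) (nest_alg qs2) \<phi>"
  obtains r U where "isometry_sum qs1 qs2 r U"
    "\<And>a. a \<in> nest_alg qs1 \<Longrightarrow> \<phi> a = isometry_sum.conj_sum U {..<r} a"
proof -
  let ?A = "nest_alg qs1"
  obtain \<psi>s where \<psi>: "\<And>\<psi>. \<psi> \<in> set \<psi>s \<Longrightarrow> star_extendible_embedding ?A (nest_alg qs2) \<psi> \<and> multiplicity_one ?A \<psi>"
    and sum: "direct_sum ?A \<phi> \<psi>s"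
    using assms(3) by (auto simp: regular_def)
  have "\<exists>U. ct U ** U = mat 1 \<and> (\<forall>a\<in>?A. (\<psi>s ! i) a = U ** a ** ct U)" if i: "i < length \<psi>s" for i
  proof -
    obtain \<pi> where \<pi>: "star_extension ?A (\<psi>s ! i) \<pi>"
      "\<And>p. projection p \<Longrightarrow> rank p = 1 \<Longrightarrow> projection (\<pi> p) \<and> rank (\<pi> p) = 1"
      using \<psi>[OF nth_mem[OF i]] by (auto simp: multiplicity_one_def)
    obtain U where "ct U ** U = mat 1" "\<And>a. \<pi> a = U ** a ** ct U"
      using star_hom_isometry[of \<pi>] \<pi> unfolding star_extension_def by metis
    thus ?thesis
      using \<pi>(1) unfolding star_extension_def by metis
  qed
  then obtain U where U: "\<And>i. i < length \<psi>s \<Longrightarrow> ct (U i) ** U i = mat 1"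
    "\<And>i a. i < length \<psi>s \<Longrightarrow> a \<in> ?A \<Longrightarrow> (\<psi>s ! i) a = U i ** a ** ct (U i)"
    by metis
  have "isometry_sum qs1 qs2 (length \<psi>s) U"
  proof
    fix i j assume ij: "i < length \<psi>s" "j < length \<psi>s"
    show "ct (U i) ** U j = (if i = j then mat 1 else 0)"
    proof (cases "i = j")
      case False
      hence "(U i ** ct (U i)) ** (U j ** ct (U j)) = 0"
        using sum ij U(2)[OF _ mat1_in_nest_alg[OF assms(1)]] by (simp add: direct_sum_def)
      hence "ct (U i) ** ((U i ** ct (U i)) ** (U j ** ct (U j))) ** U j = 0"
        by simp
      moreover have "ct (U i) ** ((U i ** ct (U i)) ** (U j ** ct (U j))) ** U j
          = (ct (U i) ** U i) ** (ct (U i) ** U j) ** (ct (U j) ** U j)"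
        by (simp add: matrix_mul_assoc)
      ultimately show ?thesis
        using False U(1) ij by simp
    qed (use U ij in simp)
  next
    fix i a assume "i < length \<psi>s" "a \<in> ?A"
    thus "U i ** a ** ct (U i) \<in> nest_alg qs2"
      using \<psi>[of "\<psi>s ! i"] U(2)[of i a]
      by (auto simp: star_extendible_embedding_def star_extendible_def)
  qed (use assms in auto)
  moreover from this have "\<phi> a = isometry_sum.conj_sum U {..<length \<psi>s} a" if "a \<in> ?A" for a
    using sum that U(2)
    by (simp add: direct_sum_def isometry_sum.conj_sum_def sum_list_sum_nth atLeast0LessThan)
  ultimately show ?thesis
    using that by blast
qed

theorem theorem3p9:
  fixes qs1 :: "(complex^'n^'n) list" and qs2 :: "(complex^'m^'m) list"
    and \<phi> :: "complex^'n^'n \<Rightarrow> complex^'m^'m"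
  assumes "nest_atoms qs1" and "nest_atoms qs2"
    and "star_extendible_embedding (nest_alg qs1) (nest_alg qs2) \<phi>"
    and "regular (nest_alg qs1) (nest_alg qs2) \<phi>"
    and "order_conserving qs1 qs2 \<phi>"
    and "order_irreducible qs1 qs2 \<phi>"
    and "\<forall>q\<in>set qs1. rank q \<noteq> 1"
  shows "T2_degenerate qs2 \<phi> \<or> refinement_type qs1 qs2 \<phi>"
proof -
  obtain r U where "isometry_sum qs1 qs2 r U"
    and \<phi>: "\<And>a. a \<in> nest_alg qs1 \<Longrightarrow> \<phi> a = isometry_sum.conj_sum U {..<r} a"
    by (rule regular_isometry_sum[OF assms(1,2,4)]) (rule that)
  then interpret isometry_sum qs1 qs2 r U by simp
  define L where "L = length qs1 - 1"
  have L: "k \<le> L \<longleftrightarrow> k < length qs1" for k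
    using nest_atoms_nonempty[OF nest1] unfolding L_def by linarith
  note oc = order_conserving_atom_map[OF \<phi> assms(5,7)]
  show ?thesis
  proof (cases "r = 0")
    \<comment> \<open>With no summands \<phi>(1) = 0, which lies below the sum of any two
      atoms.\<close>
    case True
    thus ?thesis
      using T2_degenerateI[OF \<phi>, of 0 0] nest_atoms_nonempty[OF nest2] by simp
  next
    case False
    have "(\<exists>i<r. \<forall>h<r. \<forall>k\<le>L. atom_map h k = atom_map i 0 \<or> atom_map h k = atom_map i L) \<or>
        (\<forall>i<r. \<forall>j<r. \<forall>k\<le>L. atom_map i k = atom_map j k)"
    proof (rule atom_maps_dichotomy)
      fix i j k assume "i < r" "j < r" "k \<le> L" "atom_map i k < atom_map j k"
      \<comment> \<open>The left inequality uses the pieces (k,L) in summand i and (k,k) in summand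
        j, which share the row k; the right one uses (0,k) in summand j and (k,k) in summand i,
        which share the column k.\<close>
      thus "atom_map i L \<le> atom_map j k" "atom_map i k \<le> atom_map j 0"
        using oc[of i j k L k k] oc[of j i 0 k k k] L[of L] L[of k] by auto
    next
      fix S assume "S \<subseteq> {..<r}" "S \<noteq> {}"
        "\<And>i j. i \<in> S \<Longrightarrow> j < r \<Longrightarrow> j \<notin> S \<Longrightarrow> atom_map i L \<le> atom_map j 0"
      thus "S = {..<r}"
        using order_irreducible_atom_map[OF \<phi> assms(6), of S] unfolding L_def by blast
    qed (use False atom_map_mono L in auto)
    thus ?thesis
    proof
      assume "\<exists>i<r. \<forall>h<r. \<forall>k\<le>L. atom_map h k = atom_map i 0 \<or> atom_map h k = atom_map i L"
      then obtain i where "i < r"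
        "\<And>h k. h < r \<Longrightarrow> k \<le> L \<Longrightarrow> atom_map h k = atom_map i 0 \<or> atom_map h k = atom_map i L"
        by blast
      hence "T2_degenerate qs2 \<phi>"
        using atom_map(1)[of i 0] atom_map(1)[of i L] L L[of L] nest_atoms_nonempty[OF nest1]
        by (intro T2_degenerateI[OF \<phi>, of "atom_map i 0" "atom_map i L"]) auto
      thus ?thesis ..
    next
      assume "\<forall>i<r. \<forall>j<r. \<forall>k\<le>L. atom_map i k = atom_map j k"
      hence "refinement_type qs1 qs2 \<phi>"
        unfolding L by (intro refinement_typeI[OF \<phi> assms(3)]) blast+
      thus ?thesis ..
    qed
  qed
qed

end
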